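(* Let $f,g\in\mathcal{O}_2=\mathbb{C}\{x,y\}$ be relatively prime, both vanishing at the origin, such that the foliation $\mathcal{F}_{\omega_{f/g}}$ defined by $\omega_{f/g}=g\,df-f\,dg$ has an isolated singularity at $0\in\mathbb{C}^2$. Let $\mathcal{B}=\mathcal{B}_0-\mathcal{B}_\infty$ be a balanced divisor of separatrices for $\mathcal{F}_{\omega_{f/g}}$, where $\mathcal{B}_0=fgh_1\cdots h_r$ and $\mathcal{B}_\infty=\varphi_1\cdots\varphi_r$. Then $$\tau(f,g)=\tau(\mathcal{F}_{\omega_{f/g}},\mathcal{B})=\tau(\mathcal{B}_0)-\tau(\mathcal{B}_\infty)+r(r-2)I_0(f,g).$$
   Context: $I_0(f,g)=\dim_{\mathbb{C}}\mathcal{O}_2/(f,g)$. For a reduced curve germ $C:h=0$, $\mu(C)=\dim_{\mathbb{C}}\mathcal{O}_2/(h_x,h_y)$ and $\tau(C)=\tau(h)=\dim_{\mathbb{C}}\mathcal{O}_2/(h,h_x,h_y)$. Under the isolated singularity assumption all members $C_{[\alpha:\beta]}:\alpha f+\beta g=0$ of the pencil are reduced, and they are $\mathcal{F}_{\omega_{f/g}}$-invariant. Let $\mu_{gen}$ and $\tau_{gen}$ be the minima over $[\alpha:\beta]\in\mathbb{P}^1$ of $\mu(C_{[\alpha:\beta]})$ and $\tau(C_{[\alpha:\beta]})$; each is attained for all but finitely many $[\alpha:\beta]$. The bifurcation fibers are the members with $\mu(C_{[\alpha:\beta]})>\mu_{gen}$; a generic fiber is a member with $\mu=\mu_{gen}$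 and $\tau=\tau_{gen}$. Primitive balanced divisors of separatrices of $\mathcal{F}_{\omega_{f/g}}$ (adapted to $fg=0$) are the divisors $\mathcal{B}=\mathcal{B}_0-\mathcal{B}_\infty=(f)+(g)+(h_1)+\cdots+(h_r)-(\varphi_1)-\cdots-(\varphi_r)$, where $h_1,\dots,h_r$ are the bifurcation fibers other than $f=0$ and $g=0$, and $\varphi_1,\dots,\varphi_r$ are pairwise distinct generic fibers different from $f=0$ and $g=0$. Empty products are $1$. For a reduced invariant curve $h=0$, $\tau(\mathcal{F}_{\omega_{f/g}},h):=\dim_{\mathbb{C}}\mathcal{O}_2/(gf_x-fg_x,\,gf_y-fg_y,\,h)$, and $$\tau(\mathcal{F}_{\omega_{f/g}},\mathcal{B}):=\tau(\mathcal{F}_{\omega_{f/g}},\mathcal{B}_0)-\tau(\mathcal{F}_{\omega_{f/g}},\mathcal{B}_\infty)+I_0(\mathcal{B}_0,\mathcal{B}_\infty).$$ The Tjurina number of the pair is $\tau(f,g):=\tau(\mathcal{F}_{\omega_{f/g}},\mathcal{B})$ for $\mathcal{B}$ a primitive balanced divisor of separatrices (here the given $\mathcal{B}$). *)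

theory Defs
  imports "HOL-Analysis.Analysis" "HOL-Library.Extended_Nat"
begin

section \<open>The ring of convergent power series in two variables\<close>

text \<open>
  A formal power series in two variables is an element \<open>a\<close> of \<^typ>\<open>complex fps fps\<close>; the
  coefficient of \<open>x\<^sup>i y\<^sup>j\<close> is \<open>(a $ i) $ j\<close>.  It is convergent if it converges absolutely on
  some polydisc around the origin.
\<close>

definition fps2_convergent :: "complex fps fps \<Rightarrow> bool" where
  "fps2_convergent a \<longleftrightarrow>
     (\<exists>r>0. (\<lambda>(i, j). norm (fps_nth (fps_nth a i) j) * (r ^ i * r ^ j))
              summable_on (UNIV :: (nat \<times> nat) set))"

lemma fps2_convergent_iff_bound:
  "fps2_convergent a \<longleftrightarrow> (\<exists>C R. 0 \<le> C \<and> 1 \<le> R \<and>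
     (\<forall>i j. norm (fps_nth (fps_nth a i) j) \<le> C * R ^ (i + j)))"
proof
  assume "fps2_convergent a"
  then obtain r where r: "r > 0" and
    s: "(\<lambda>(i, j). norm (fps_nth (fps_nth a i) j) * (r ^ i * r ^ j)) summable_on (UNIV :: (nat \<times> nat) set)"
    unfolding fps2_convergent_def by blast
  define g where "g = (\<lambda>(i, j). norm (fps_nth (fps_nth a i) j) * (r ^ i * r ^ j))"
  define C where "C = infsum g UNIV"
  define R where "R = max 1 (1 / r)"
  have gs: "g summable_on UNIV" using s unfolding g_def .
  have g0: "g p \<ge> 0" for p using r by (auto simp: g_def split: prod.split)
  have gC: "g p \<le> C" for p
  proof -
    have "sum g {p} \<le> infsum g UNIV"
      by (rule finite_sum_le_infsum[OF gs]) (auto simp: g0)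
    then show ?thesis by (simp add: C_def)
  qed
  have C0: "C \<ge> 0" using gC[of "(0,0)"] g0[of "(0,0)"] by linarith
  have "norm (fps_nth (fps_nth a i) j) \<le> C * R ^ (i + j)" for i j
  proof -
    have "norm (fps_nth (fps_nth a i) j) * r ^ (i + j) \<le> C"
      using gC[of "(i,j)"] r by (simp add: g_def norm_mult norm_power power_add)
    then have "norm (fps_nth (fps_nth a i) j) \<le> C * (1 / r) ^ (i + j)"
      using r by (simp add: field_simps)
    also have "\<dots> \<le> C * R ^ (i + j)"
      by (intro mult_left_mono power_mono C0) (use r in \<open>auto simp: R_def\<close>)
    finally show ?thesis .
  qed
  then show "\<exists>C R. 0 \<le> C \<and> 1 \<le> R \<and>
     (\<forall>i j. norm (fps_nth (fps_nth a i) j) \<le> C * R ^ (i + j))"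
    using C0 by (intro exI[of _ C] exI[of _ R]) (auto simp: R_def)
next
  assume "\<exists>C R. 0 \<le> C \<and> 1 \<le> R \<and>
     (\<forall>i j. norm (fps_nth (fps_nth a i) j) \<le> C * R ^ (i + j))"
  then obtain C R where C: "0 \<le> C" and R: "1 \<le> R"
    and b: "\<And>i j. norm (fps_nth (fps_nth a i) j) \<le> C * R ^ (i + j)" by blast
  define r where "r = 1 / (2 * R)"
  have r: "r > 0" using R by (simp add: r_def)
  have geo: "((\<lambda>n. (1/2::real) ^ n) has_sum 2) UNIV"
    using geometric_sums[of "1/2::real"]
    by (subst norm_summable_imp_has_sum) (auto simp: summable_geometric)
  have hs: "(\<lambda>(i, j). C * ((1/2::real) ^ i * (1/2) ^ j)) summable_on Sigma UNIV (\<lambda>_. UNIV)"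
  proof (rule summable_on_SigmaI)
    show "((\<lambda>y. (case (x, y) of (i, j) \<Rightarrow> C * ((1/2::real) ^ i * (1/2) ^ j))) has_sum C * ((1/2)^x * 2)) UNIV" for x
      using has_sum_cmult_right[OF geo, of "C * (1/2)^x"] by (simp add: mult.assoc)
    show "(\<lambda>x. C * ((1/2::real)^x * 2)) summable_on UNIV"
      using has_sum_imp_summable[OF has_sum_cmult_right[OF geo, of "C * 2"]] by (simp add: mult_ac)
  qed (use C in auto)
  have "(\<lambda>(i, j). norm (fps_nth (fps_nth a i) j) * (r ^ i * r ^ j)) summable_on (UNIV :: (nat \<times> nat) set)"
  proof (rule summable_on_comparison_test)
    show "(\<lambda>(i, j). C * ((1/2::real) ^ i * (1/2) ^ j)) summable_on (UNIV :: (nat \<times> nat) set)"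
      using hs by simp
    fix p :: "nat \<times> nat"
    obtain i j where p: "p = (i, j)" by (cases p)
    show "0 \<le> (case p of (i, j) \<Rightarrow> norm (fps_nth (fps_nth a i) j) * (r ^ i * r ^ j))"
      using r by (simp add: p)
    have "norm (fps_nth (fps_nth a i) j) * r ^ (i + j) \<le> C * R ^ (i + j) * r ^ (i + j)"
      by (intro mult_right_mono b) (use r in auto)
    also have "\<dots> = C * (R * r) ^ (i + j)" by (simp add: power_mult_distrib)
    also have "R * r = 1 / 2" using R by (simp add: r_def)
    finally show "(case p of (i, j) \<Rightarrow> norm (fps_nth (fps_nth a i) j) * (r ^ i * r ^ j))
        \<le> (case p of (i, j) \<Rightarrow> C * ((1/2::real) ^ i * (1/2) ^ j))"
      by (simp add: p power_add)
  qed
  then show "fps2_convergent a" unfolding fps2_convergent_def using r by blast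
qed

lemma fps2_convergentI:
  assumes "0 \<le> C" "1 \<le> R" "\<And>i j. norm (fps_nth (fps_nth a i) j) \<le> C * R ^ (i + j)"
  shows "fps2_convergent a"
  using assms by (auto simp: fps2_convergent_iff_bound)

lemma fps2_convergent_const: "fps2_convergent (fps_const (fps_const c))"
proof (rule fps2_convergentI[of "norm c" 1])
  show "norm (fps_nth (fps_nth (fps_const (fps_const c)) i) j) \<le> norm c * 1 ^ (i + j)" for i j
    by (cases "i = 0"; cases "j = 0") auto
qed auto

lemma fps2_convergent_add:
  assumes "fps2_convergent a" "fps2_convergent b"
  shows "fps2_convergent (a + b)"
proof -
  obtain C R where a: "0 \<le> C" "1 \<le> R" "\<And>i j. norm (fps_nth (fps_nth a i) j) \<le> C * R ^ (i + j)"
    using assms(1) by (auto simp: fps2_convergent_iff_bound)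
  obtain D S where b: "0 \<le> D" "1 \<le> S" "\<And>i j. norm (fps_nth (fps_nth b i) j) \<le> D * S ^ (i + j)"
    using assms(2) by (auto simp: fps2_convergent_iff_bound)
  show ?thesis
  proof (rule fps2_convergentI[of "C + D" "R * S"])
    show "1 \<le> R * S" using mult_mono[of 1 R 1 S] a b by simp
    fix i j
    have "R ^ (i + j) * 1 \<le> R ^ (i + j) * S ^ (i + j)"
      by (intro mult_left_mono) (use a b in auto)
    moreover have "1 * S ^ (i + j) \<le> R ^ (i + j) * S ^ (i + j)"
      by (intro mult_right_mono) (use a b in auto)
    ultimately have "C * R ^ (i + j) + D * S ^ (i + j) \<le> (C + D) * (R * S) ^ (i + j)"
      using a(1) b(1) by (simp add: distrib_right power_mult_distrib add_mono mult_left_mono)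
    then show "norm (fps_nth (fps_nth (a + b) i) j) \<le> (C + D) * (R * S) ^ (i + j)"
      using a(3)[of i j] b(3)[of i j]
        norm_triangle_ineq[of "fps_nth (fps_nth a i) j" "fps_nth (fps_nth b i) j"] by simp
  qed (use a b in auto)
qed

lemma fps2_convergent_uminus: "fps2_convergent a \<Longrightarrow> fps2_convergent (- a)"
  by (simp add: fps2_convergent_iff_bound)

lemma fps2_convergent_diff:
  "fps2_convergent a \<Longrightarrow> fps2_convergent b \<Longrightarrow> fps2_convergent (a - b)"
  using fps2_convergent_add[of a "- b"] fps2_convergent_uminus[of b] by simp

lemma fps2_convergent_mult:
  assumes "fps2_convergent a" "fps2_convergent b"
  shows "fps2_convergent (a * b)"
proof -
  obtain C R where a: "0 \<le> C" "1 \<le> R" "\<And>i j. norm (fps_nth (fps_nth a i) j) \<le> C * R ^ (i + j)"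
    using assms(1) by (auto simp: fps2_convergent_iff_bound)
  obtain D S where b: "0 \<le> D" "1 \<le> S" "\<And>i j. norm (fps_nth (fps_nth b i) j) \<le> D * S ^ (i + j)"
    using assms(2) by (auto simp: fps2_convergent_iff_bound)
  have RS: "1 \<le> R * S" using mult_mono[of 1 R 1 S] a b by simp
  show ?thesis
  proof (rule fps2_convergentI[of "C * D" "2 * (R * S)"])
    fix i j
    have S1: "norm (fps_nth (fps_nth a k) l * fps_nth (fps_nth b (i - k)) (j - l))
           \<le> C * D * (R * S) ^ (i + j)" if "k \<le> i" "l \<le> j" for k l
    proof -
      have "norm (fps_nth (fps_nth a k) l * fps_nth (fps_nth b (i - k)) (j - l))
          \<le> (C * R ^ (k + l)) * (D * S ^ (i - k + (j - l)))"
        unfolding norm_mult by (intro mult_mono a(3) b(3)) (use a b in auto)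
      also have "\<dots> \<le> (C * R ^ (i + j)) * (D * S ^ (i + j))"
        by (intro mult_mono mult_left_mono power_increasing) (use a b that in auto)
      finally show ?thesis by (simp add: power_mult_distrib mult_ac)
    qed
    have "norm (fps_nth (fps_nth (a * b) i) j)
        = norm (\<Sum>k=0..i. \<Sum>l=0..j. fps_nth (fps_nth a k) l * fps_nth (fps_nth b (i - k)) (j - l))"
      by (simp add: fps_mult_nth fps_sum_nth)
    also have "\<dots> \<le> (\<Sum>k=0..i. \<Sum>l=0..j. C * D * (R * S) ^ (i + j))"
      by (intro sum_norm_le S1) auto
    also have "\<dots> = real (Suc i) * real (Suc j) * (C * D * (R * S) ^ (i + j))" by simp
    also have "\<dots> \<le> 2 ^ i * 2 ^ j * (C * D * (R * S) ^ (i + j))"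
    proof -
      have "real (Suc n) \<le> 2 ^ n" for n
        using Suc_leI[OF less_exp[of n]] by (metis of_nat_le_iff of_nat_numeral of_nat_power)
      then show ?thesis
        by (intro mult_right_mono mult_mono) (use a b RS in auto)
    qed
    finally show "norm (fps_nth (fps_nth (a * b) i) j) \<le> C * D * (2 * (R * S)) ^ (i + j)"
      by (simp add: power_mult_distrib power_add mult_ac)
  qed (use a b RS in auto)
qed

typedef conv_series = "{a. fps2_convergent a}"
  morphisms fps_of_conv conv_of_fps
  using fps2_convergent_const by blast

setup_lifting type_definition_conv_series

lift_definition conv_coeff :: "conv_series \<Rightarrow> nat \<Rightarrow> nat \<Rightarrow> complex"
  is "\<lambda>a i j. fps_nth (fps_nth a i) j" .

lift_definition conv_const :: "complex \<Rightarrow> conv_series"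
  is "\<lambda>c. fps_const (fps_const c)" by (rule fps2_convergent_const)

instantiation conv_series :: idom
begin

lift_definition zero_conv_series :: conv_series is 0
  using fps2_convergent_const[of 0] by simp
lift_definition one_conv_series :: conv_series is 1
  using fps2_convergent_const[of 1] by simp
lift_definition plus_conv_series :: "conv_series \<Rightarrow> conv_series \<Rightarrow> conv_series" is "(+)"
  by (rule fps2_convergent_add)
lift_definition minus_conv_series :: "conv_series \<Rightarrow> conv_series \<Rightarrow> conv_series" is "(-)"
  by (rule fps2_convergent_diff)
lift_definition uminus_conv_series :: "conv_series \<Rightarrow> conv_series" is "uminus"
  by (rule fps2_convergent_uminus)
lift_definition times_conv_series :: "conv_series \<Rightarrow> conv_series \<Rightarrow> conv_series" is "(*)"
  by (rule fps2_convergent_mult)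

instance
  by standard (transfer; simp add: algebra_simps)+

end

text \<open>Division is only introduced to have \<^const>\<open>coprime\<close> available.\<close>

instantiation conv_series :: algebraic_semidom
begin

definition divide_conv_series :: "conv_series \<Rightarrow> conv_series \<Rightarrow> conv_series" where
  "divide_conv_series a b = (if b \<noteq> 0 \<and> b dvd a then (THE q. a = q * b) else 0)"

instance
proof
  fix a b :: conv_series
  assume "b \<noteq> 0"
  then show "a * b div b = a"
    by (auto simp: divide_conv_series_def intro!: the_equality)
qed (simp add: divide_conv_series_def)

end

definition conv_eval :: "conv_series \<Rightarrow> complex \<times> complex \<Rightarrow> complex" where
  "conv_eval a z = (\<Sum>\<^sub>\<infinity>(i, j)\<in>UNIV. conv_coeff a i j * fst z ^ i * snd z ^ j)"

lemma fps2_convergent_deriv_bound: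
  assumes "fps2_convergent a"
    and "\<And>i j. norm (fps_nth (fps_nth b i) j) \<le>
           real (i + j + 1) * (norm (fps_nth (fps_nth a (Suc i)) j) + norm (fps_nth (fps_nth a i) (Suc j)))"
  shows "fps2_convergent b"
proof -
  obtain C R where a: "0 \<le> C" "1 \<le> R" "\<And>i j. norm (fps_nth (fps_nth a i) j) \<le> C * R ^ (i + j)"
    using assms(1) by (auto simp: fps2_convergent_iff_bound)
  show ?thesis
  proof (rule fps2_convergentI[of "2 * C * R" "2 * R"])
    fix i j
    have "real (i + j + 1) \<le> 2 ^ (i + j)"
      using Suc_leI[OF less_exp[of "i + j"]]
      by (metis Suc_eq_plus1 of_nat_le_iff of_nat_numeral of_nat_power)
    then have "real (i + j + 1) * (norm (fps_nth (fps_nth a (Suc i)) j) + norm (fps_nth (fps_nth a i) (Suc j)))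
        \<le> 2 ^ (i + j) * (C * R ^ (Suc i + j) + C * R ^ (i + Suc j))"
      by (intro mult_mono add_mono a(3)) auto
    also have "\<dots> = 2 * C * R * (2 * R) ^ (i + j)"
      by (simp add: power_mult_distrib algebra_simps)
    finally show "norm (fps_nth (fps_nth b i) j) \<le> 2 * C * R * (2 * R) ^ (i + j)"
      using assms(2)[of i j] by linarith
  qed (use a in auto)
qed

lift_definition conv_dx :: "conv_series \<Rightarrow> conv_series" is fps_deriv
proof -
  fix a :: "complex fps fps" assume "fps2_convergent a"
  then show "fps2_convergent (fps_deriv a)"
  proof (rule fps2_convergent_deriv_bound)
    fix i j
    have eq: "fps_nth (fps_nth (fps_deriv a) i) j = of_nat (i + 1) * fps_nth (fps_nth a (Suc i)) j"
      by (metis Suc_eq_plus1 fps_deriv_nth fps_mult_of_nat_nth(1))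
    have "norm (fps_nth (fps_nth (fps_deriv a) i) j) = real (i + 1) * norm (fps_nth (fps_nth a (Suc i)) j)"
      unfolding eq norm_mult norm_of_nat by simp
    also have "\<dots> \<le> real (i + j + 1) * (norm (fps_nth (fps_nth a (Suc i)) j) + norm (fps_nth (fps_nth a i) (Suc j)))"
      by (intro mult_mono) auto
    finally show "norm (fps_nth (fps_nth (fps_deriv a) i) j) \<le> \<dots>" .
  qed
qed

lift_definition conv_dy :: "conv_series \<Rightarrow> conv_series" is "\<lambda>a. Abs_fps (\<lambda>i. fps_deriv (fps_nth a i))"
proof -
  fix a :: "complex fps fps" assume "fps2_convergent a"
  then show "fps2_convergent (Abs_fps (\<lambda>i. fps_deriv (fps_nth a i)))"
  proof (rule fps2_convergent_deriv_bound)
    fix i j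
    have "norm (fps_nth (fps_nth (Abs_fps (\<lambda>i. fps_deriv (fps_nth a i))) i) j)
        = real (j + 1) * norm (fps_nth (fps_nth a i) (Suc j))"
      by (simp add: norm_mult del: of_nat_Suc of_nat_add)
    also have "\<dots> \<le> real (i + j + 1) * (norm (fps_nth (fps_nth a (Suc i)) j) + norm (fps_nth (fps_nth a i) (Suc j)))"
      by (intro mult_mono) auto
    finally show "norm (fps_nth (fps_nth (Abs_fps (\<lambda>i. fps_deriv (fps_nth a i))) i) j) \<le> \<dots>" .
  qed
qed

lemma conv_coeff_dx: "conv_coeff (conv_dx a) i j = of_nat (i + 1) * conv_coeff a (i + 1) j"
  by transfer (metis fps_deriv_nth fps_mult_of_nat_nth(1))

lemma conv_coeff_dy: "conv_coeff (conv_dy a) i j = of_nat (j + 1) * conv_coeff a i (j + 1)"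
  by transfer simp


section \<open>Complex dimension of a quotient\<close>

definition conv_scale :: "complex \<Rightarrow> conv_series \<Rightarrow> conv_series" where
  "conv_scale c a = conv_const c * a"

interpretation conv_vs: vector_space conv_scale
  unfolding conv_scale_def
  by unfold_locales (transfer; simp add: algebra_simps flip: fps_const_add fps_const_mult)+

interpretation conv_mod: module "(*) :: conv_series \<Rightarrow> conv_series \<Rightarrow> conv_series"
  by unfold_locales (simp_all add: algebra_simps)

abbreviation conv_ideal :: "conv_series set \<Rightarrow> conv_series set" where
  "conv_ideal \<equiv> conv_mod.span"

text \<open>The residue classes of the elements of \<open>B\<close> are distinct and form a \<open>\<complex>\<close>-basis of the quotient
  by the subspace \<open>I\<close>; by \<open>quot_dim_eqI\<close> below, \<open>quot_dim\<close> does not depend on the choice of \<open>B\<close>.\<close>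

definition basis_mod :: "conv_series set \<Rightarrow> conv_series set \<Rightarrow> bool" where
  "basis_mod I B \<longleftrightarrow> conv_vs.independent B \<and> conv_vs.span B \<inter> I = {0} \<and>
                    conv_vs.span (B \<union> I) = UNIV"

definition quot_dim :: "conv_series set \<Rightarrow> enat" where
  "quot_dim I = (if \<exists>B. finite B \<and> basis_mod I B
                 then enat (card (SOME B. finite B \<and> basis_mod I B)) else \<infinity>)"

lemma basis_mod_card_le:
  assumes I: "conv_vs.subspace I" and B: "basis_mod I B" and B': "basis_mod I B'" "finite B'"
  shows "card B \<le> card B'"
proof -
  interpret p: vector_space_pair conv_scale conv_scale ..
  have "\<exists>s. s \<in> conv_vs.span B' \<and> s - b \<in> I" for b
  proof -
    have "b \<in> conv_vs.span (B' \<union> I)" using B' by (simp add: basis_mod_def)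
    then obtain s t where "s \<in> conv_vs.span B'" "t \<in> conv_vs.span I" "b = s + t"
      unfolding conv_vs.span_Un by blast
    moreover from this have "t \<in> I" using conv_vs.span_subspace[OF order_refl _ I] conv_vs.span_superset by blast
    then have "- t \<in> I" by (rule conv_vs.subspace_neg[OF I])
    ultimately show ?thesis by (intro exI[of _ s]) simp
  qed
  then obtain s where s: "\<And>b. s b \<in> conv_vs.span B'" "\<And>b. s b - b \<in> I" by metis
  have ind: "conv_vs.independent B" using B by (simp add: basis_mod_def)
  define T where "T = p.construct B s"
  have lin: "Vector_Spaces.linear conv_scale conv_scale T"
    unfolding T_def by (rule p.linear_construct[OF ind])
  have Tb: "T b = s b" if "b \<in> B" for b
    unfolding T_def by (rule p.construct_basis[OF ind that])
  have TI: "T x - x \<in> I" if "x \<in> conv_vs.span B" for x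
    using that
  proof (induction rule: conv_vs.span_induct_alt)
    case base
    then show ?case using p.linear_0[OF lin] conv_vs.subspace_0[OF I] by simp
  next
    case (step c x y)
    have "T (conv_scale c x + y) - (conv_scale c x + y) = conv_scale c (s x - x) + (T y - y)"
      using p.linear_add[OF lin] p.linear_scale[OF lin] Tb[OF step(1)]
      by (simp add: conv_vs.scale_right_diff_distrib)
    moreover have "\<dots> \<in> I"
      by (intro conv_vs.subspace_add[OF I] conv_vs.subspace_scale[OF I] s(2) step(2))
    ultimately show ?case by (simp only:)
  qed
  have inj: "inj_on T (conv_vs.span B)"
  proof (subst p.linear_inj_on_iff_eq_0[OF lin conv_vs.subspace_span], intro ballI impI)
    fix x assume x: "x \<in> conv_vs.span B" "T x = 0"
    then have "- x \<in> I" using TI[of x] by simp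
    then have "x \<in> I" using conv_vs.subspace_neg[OF I, of "- x"] by simp
    then show "x = 0" using x B by (auto simp: basis_mod_def)
  qed
  have "conv_vs.independent (T ` B)"
    by (rule p.linear_independent_injective_image[OF lin ind inj])
  moreover have "T ` B \<subseteq> conv_vs.span B'" using Tb s by auto
  ultimately have "card (T ` B) \<le> card B'"
    using conv_vs.independent_span_bound[OF B'(2)] by blast
  moreover have "inj_on T B" using inj conv_vs.span_superset inj_on_subset by blast
  ultimately show ?thesis by (simp add: card_image)
qed

lemma conv_subspace_ideal: "conv_vs.subspace (conv_ideal S)"
  unfolding conv_vs.subspace_def conv_scale_def
  by (intro conjI ballI allI conv_mod.span_zero conv_mod.span_add conv_mod.span_scale)

lemma quot_dim_eqI:
  assumes "conv_vs.subspace I" "finite B" "basis_mod I B"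
  shows "quot_dim I = enat (card B)"
proof -
  let ?B = "SOME B. finite B \<and> basis_mod I B"
  have ex: "\<exists>B. finite B \<and> basis_mod I B" using assms by blast
  have "finite ?B \<and> basis_mod I ?B" by (rule someI_ex[OF ex])
  then have "card ?B = card B"
    by (intro antisym basis_mod_card_le[OF assms(1)]) (use assms in simp_all)
  then show ?thesis unfolding quot_dim_def using ex by (simp only: if_True)
qed


section \<open>Invariants of curve germs and of pencils\<close>

definition intersection_number :: "conv_series \<Rightarrow> conv_series \<Rightarrow> enat" where
  "intersection_number f g = quot_dim (conv_ideal {f, g})"

definition milnor_number :: "conv_series \<Rightarrow> enat" where
  "milnor_number h = quot_dim (conv_ideal {conv_dx h, conv_dy h})"

definition tjurina_number :: "conv_series \<Rightarrow> enat" where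
  "tjurina_number h = quot_dim (conv_ideal {h, conv_dx h, conv_dy h})"

text \<open>The coefficients of \<open>dx\<close> and \<open>dy\<close> in the 1-form \<open>g df - f dg\<close>.\<close>

definition omega_x :: "conv_series \<Rightarrow> conv_series \<Rightarrow> conv_series" where
  "omega_x f g = g * conv_dx f - f * conv_dx g"

definition omega_y :: "conv_series \<Rightarrow> conv_series \<Rightarrow> conv_series" where
  "omega_y f g = g * conv_dy f - f * conv_dy g"

definition isolated_singularity :: "conv_series \<Rightarrow> conv_series \<Rightarrow> bool" where
  "isolated_singularity f g \<longleftrightarrow>
     conv_eval (omega_x f g) 0 = 0 \<and> conv_eval (omega_y f g) 0 = 0 \<and>
     (\<forall>\<^sub>F z in at 0. \<not> (conv_eval (omega_x f g) z = 0 \<and> conv_eval (omega_y f g) z = 0))"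

text \<open>Points \<open>[\<alpha>:\<beta>]\<close> of the projective line are given by representatives \<open>(\<alpha>, \<beta>) \<noteq> 0\<close>.\<close>

definition same_point :: "complex \<times> complex \<Rightarrow> complex \<times> complex \<Rightarrow> bool" where
  "same_point p q \<longleftrightarrow> (\<exists>c. c \<noteq> 0 \<and> fst q = c * fst p \<and> snd q = c * snd p)"

definition member :: "conv_series \<Rightarrow> conv_series \<Rightarrow> complex \<times> complex \<Rightarrow> conv_series" where
  "member f g p = conv_scale (fst p) f + conv_scale (snd p) g"

definition mu_gen :: "conv_series \<Rightarrow> conv_series \<Rightarrow> enat" where
  "mu_gen f g = (INF p\<in>-{0}. milnor_number (member f g p))"

definition tau_gen :: "conv_series \<Rightarrow> conv_series \<Rightarrow> enat" where
  "tau_gen f g = (INF p\<in>-{0}. tjurina_number (member f g p))"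

definition bifurcation_point :: "conv_series \<Rightarrow> conv_series \<Rightarrow> complex \<times> complex \<Rightarrow> bool" where
  "bifurcation_point f g p \<longleftrightarrow> p \<noteq> 0 \<and> milnor_number (member f g p) > mu_gen f g"

definition generic_point :: "conv_series \<Rightarrow> conv_series \<Rightarrow> complex \<times> complex \<Rightarrow> bool" where
  "generic_point f g p \<longleftrightarrow> p \<noteq> 0 \<and> milnor_number (member f g p) = mu_gen f g \<and>
                            tjurina_number (member f g p) = tau_gen f g"

text \<open>An equation of the curve germ \<open>C\<^bsub>[\<alpha>:\<beta>]\<^esub>\<close> is determined up to a unit.\<close>

definition equation_of :: "conv_series \<Rightarrow> conv_series \<Rightarrow> complex \<times> complex \<Rightarrow> conv_series \<Rightarrow> bool" where
  "equation_of f g p h \<longleftrightarrow> (\<exists>u. is_unit u \<and> h = u * member f g p)"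

text \<open>The divisor \<open>(f) + (g) + \<Sum>\<^sub>i (h\<^sub>i) - \<Sum>\<^sub>i (\<phi>\<^sub>i)\<close>, \<open>i < r\<close>, with \<open>p\<^sub>i\<close> and \<open>q\<^sub>i\<close> the points of the
  projective line belonging to \<open>h\<^sub>i\<close> and \<open>\<phi>\<^sub>i\<close>.  The points \<open>(1, 0)\<close> and \<open>(0, 1)\<close> correspond to
  \<open>f = 0\<close> and \<open>g = 0\<close>.\<close>

definition primitive_balanced_divisor ::
    "conv_series \<Rightarrow> conv_series \<Rightarrow> nat \<Rightarrow> (nat \<Rightarrow> conv_series) \<Rightarrow> (nat \<Rightarrow> conv_series) \<Rightarrow> bool" where
  "primitive_balanced_divisor f g r h \<phi> \<longleftrightarrow> (\<exists>p q.
     (\<forall>i<r. bifurcation_point f g (p i) \<and> \<not> same_point (p i) (1, 0) \<and> \<not> same_point (p i) (0, 1) \<and>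
            equation_of f g (p i) (h i)) \<and>
     (\<forall>i<r. \<forall>j<r. i \<noteq> j \<longrightarrow> \<not> same_point (p i) (p j)) \<and>
     (\<forall>s. bifurcation_point f g s \<and> \<not> same_point s (1, 0) \<and> \<not> same_point s (0, 1) \<longrightarrow>
            (\<exists>i<r. same_point s (p i))) \<and>
     (\<forall>i<r. generic_point f g (q i) \<and> \<not> same_point (q i) (1, 0) \<and> \<not> same_point (q i) (0, 1) \<and>
            equation_of f g (q i) (\<phi> i)) \<and>
     (\<forall>i<r. \<forall>j<r. i \<noteq> j \<longrightarrow> \<not> same_point (q i) (q j)))"

definition zero_part :: "conv_series \<Rightarrow> conv_series \<Rightarrow> nat \<Rightarrow> (nat \<Rightarrow> conv_series) \<Rightarrow> conv_series" where
  "zero_part f g r h = f * g * (\<Prod>i<r. h i)"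

definition pole_part :: "nat \<Rightarrow> (nat \<Rightarrow> conv_series) \<Rightarrow> conv_series" where
  "pole_part r \<phi> = (\<Prod>i<r. \<phi> i)"

text \<open>The Tjurina number of the foliation along the curve \<open>h = 0\<close>, and along the divisor
  \<open>(B0) - (Boo)\<close>.\<close>

definition tjurina_fol :: "conv_series \<Rightarrow> conv_series \<Rightarrow> conv_series \<Rightarrow> enat" where
  "tjurina_fol f g h = quot_dim (conv_ideal {omega_x f g, omega_y f g, h})"

definition tjurina_fol_div :: "conv_series \<Rightarrow> conv_series \<Rightarrow> conv_series \<Rightarrow> conv_series \<Rightarrow> int" where
  "tjurina_fol_div f g B0 Boo =
     int (the_enat (tjurina_fol f g B0)) - int (the_enat (tjurina_fol f g Boo))
     + int (the_enat (intersection_number B0 Boo))"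

text \<open>The Tjurina number of the pair, relative to a chosen primitive balanced divisor.\<close>

definition tjurina_pair ::
    "conv_series \<Rightarrow> conv_series \<Rightarrow> nat \<Rightarrow> (nat \<Rightarrow> conv_series) \<Rightarrow> (nat \<Rightarrow> conv_series) \<Rightarrow> int" where
  "tjurina_pair f g r h \<phi> = tjurina_fol_div f g (zero_part f g r h) (pole_part r \<phi>)"

end

theory Submission
  imports Defs "HOL-Computational_Algebra.Fundamental_Theorem_Algebra"
begin

text \<open>
  Let \<open>H\<close> be a product of \<open>n\<close> distinct members \<open>l\<^sub>i\<close> of the pencil and \<open>L\<close> a member different from
  all of them.  Since \<open>L dl\<^sub>i - l\<^sub>i dL\<close> is a non-zero constant multiple \<open>d\<^sub>i \<omega>\<close> of \<open>\<omega> = g df - f dg\<close>,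
  we have \<open>L dH = n H dL + E \<omega>\<close> with \<open>E = \<Sum>\<^sub>i d\<^sub>i \<Prod>\<^sub>k\<^sub>\<noteq>\<^sub>i l\<^sub>k\<close>.  Both \<open>L\<close> and \<open>E\<close> are regular modulo \<open>H\<close>,
  so comparing colengths gives \<open>I(H, L) + \<tau>(H) = I(H, E) + \<tau>(F, H)\<close>.  Any two distinct members generate
  the ideal \<open>(f, g)\<close>, hence \<open>I(H, L) = n I(f, g)\<close>, \<open>I(H, E) = n (n - 1) I(f, g)\<close> and
  \<open>\<tau>(F, H) = \<tau>(H) - n (n - 2) I(f, g)\<close>.  The theorem is this formula for \<open>n = r + 2\<close> and \<open>n = r\<close>,
  combined with \<open>I(B0, Boo) = (r + 2) r I(f, g)\<close>.

  Finiteness and regularity come from the isolated common zero: one of the two series is \<open>y\<close>-regular,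
  Weierstrass division makes the quotient by it a finite module over \<open>\<complex>{x}\<close>, and counting the roots
  of the Weierstrass polynomial on the lines \<open>x = const\<close> shows that the other series acts injectively.
\<close>

section \<open>Weierstrass division\<close>

text \<open>For the module of the ring over itself this rule reads \<open>a * (b * c) = a * b * c\<close> and loops with
  \<open>mult.assoc\<close>.\<close>

declare conv_mod.scale_scale [simp del]

section \<open>Coefficients of convergent series\<close>

lemma conv_coeff_simps [simp]:
  "conv_coeff (a + b) i j = conv_coeff a i j + conv_coeff b i j"
  "conv_coeff (a - b) i j = conv_coeff a i j - conv_coeff b i j"
  "conv_coeff (- a) i j = - conv_coeff a i j"
  "conv_coeff 0 i j = 0"
  "conv_coeff (conv_scale c a) i j = c * conv_coeff a i j"
  unfolding conv_scale_def by (transfer; simp)+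

lemma conv_coeff_sum [simp]: "conv_coeff (sum a S) i j = (\<Sum>s\<in>S. conv_coeff (a s) i j)"
  by (induction S rule: infinite_finite_induct) auto

lemma conv_coeff_one [simp]: "conv_coeff 1 i j = (if i = 0 \<and> j = 0 then 1 else 0)"
  by transfer simp

lemma conv_coeff_mult:
  "conv_coeff (a * b) i j = (\<Sum>k\<le>i. \<Sum>l\<le>j. conv_coeff a k l * conv_coeff b (i - k) (j - l))"
  by transfer (simp add: fps_mult_nth fps_sum_nth atLeast0AtMost)

lemma conv_series_eqI: "(\<And>i j. conv_coeff a i j = conv_coeff b i j) \<Longrightarrow> a = b"
  by transfer (simp add: fps_eq_iff)

lemma conv_coeff_bound:
  obtains C R where "C > 0" "R \<ge> 1" "\<And>i j. norm (conv_coeff a i j) \<le> C * R ^ (i + j)"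
proof -
  have "fps2_convergent (fps_of_conv a)" using fps_of_conv by blast
  then obtain C R where *: "0 \<le> C" "1 \<le> R"
      "\<And>i j. norm (conv_coeff a i j) \<le> C * R ^ (i + j)"
    by (auto simp: fps2_convergent_iff_bound conv_coeff.rep_eq)
  have "norm (conv_coeff a i j) \<le> (C + 1) * R ^ (i + j)" for i j
    by (rule order_trans[OF *(3)]) (use *(2) in \<open>simp add: distrib_right\<close>)
  with * show ?thesis by (intro that[of "C + 1" R]) auto
qed

lemma conv_series_exists:
  assumes "0 \<le> C" "1 \<le> R" "\<And>i j. norm (c i j) \<le> C * R ^ (i + j)"
  obtains a where "\<And>i j. conv_coeff a i j = c i j"
proof -
  have "fps2_convergent (Abs_fps (\<lambda>i. Abs_fps (c i)))"
    by (rule fps2_convergentI[of C R]) (use assms in auto)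
  then have "conv_coeff (conv_of_fps (Abs_fps (\<lambda>i. Abs_fps (c i)))) i j = c i j" for i j
    by (simp add: conv_coeff.rep_eq conv_of_fps_inverse)
  then show ?thesis using that by blast
qed

text \<open>This is division by \<open>x ^ k\<close> once the terms of lower degree in x are
  dropped; the shift only enlarges the constant of the coefficient bound, by the factor
  \<open>R ^ k\<close>.\<close>

lemma conv_coeff_shift:
  obtains b where "\<And>i j. conv_coeff b i j = conv_coeff a (i + k) j"
proof -
  obtain C R where *: "C > 0" "R \<ge> 1" "\<And>i j. norm (conv_coeff a i j) \<le> C * R ^ (i + j)"
    by (rule conv_coeff_bound[of a]) (rule that)
  show ?thesis
  proof (rule conv_series_exists[of "C * R ^ k" R "\<lambda>i j. conv_coeff a (i + k) j"])
    show "norm (conv_coeff a (i + k) j) \<le> C * R ^ k * R ^ (i + j)" for i j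
      using *(3)[of "i + k" j] * by (auto simp: power_add mult_ac)
  qed (use * in \<open>auto intro: that\<close>)
qed

lemma sum_geometric_le:
  assumes "0 \<le> x" "x \<le> 1/2"
  shows "(\<Sum>k\<le>n. x ^ k) \<le> (2::real)" "(\<Sum>k=1..n. x ^ k) \<le> 2 * x"
proof -
  have "(\<Sum>k<m. x ^ k) \<le> 2" for m
  proof -
    have "(\<Sum>k<m. x ^ k) = (1 - x ^ m) / (1 - x)"
      using assms by (subst sum_gp_strict) auto
    also have "\<dots> \<le> 2" using assms by (simp add: divide_simps)
        (use zero_le_power[of x m] in linarith)
    finally show ?thesis .
  qed
  then show 1: "(\<Sum>k\<le>n. x ^ k) \<le> 2" for n
    by (metis lessThan_Suc_atMost)
  have "(\<Sum>k=1..n. x ^ k) \<le> (\<Sum>k=1..Suc n. x ^ k)"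
    by (rule sum_mono2) (use assms in auto)
  also have "\<dots> = x * (\<Sum>k\<le>n. x ^ k)"
    unfolding sum_distrib_left
    by (rule sum.reindex_bij_witness[of _ Suc "\<lambda>k. k - 1"]) (auto simp: power_eq_if)
  also have "\<dots> \<le> x * 2" by (rule mult_left_mono[OF 1 assms(1)])
  finally show "(\<Sum>k=1..n. x ^ k) \<le> 2 * x" by simp
qed

text \<open>Comparing the coefficients of \<open>x\<^sup>i y\<^sup>j\<^sup>+\<^sup>n\<close> in \<open>g = q a + r\<close> determines \<open>q\<close> recursively, in
  lexicographic order of \<open>(i, j)\<close>.\<close>

fun weierstrass_quot ::
    "nat \<Rightarrow> (nat \<Rightarrow> nat \<Rightarrow> complex) \<Rightarrow> (nat \<Rightarrow> nat \<Rightarrow> complex) \<Rightarrow> nat \<Rightarrow> nat \<Rightarrow> complex" where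
  "weierstrass_quot n a g i j =
     (g i (j + n) - (\<Sum>l\<in>{n+1..j+n}. a 0 l * weierstrass_quot n a g i (j + n - l))
       - (\<Sum>k\<in>{1..i}. \<Sum>l\<in>{..j+n}. a k l * weierstrass_quot n a g (i - k) (j + n - l))) / a 0 n"

declare weierstrass_quot.simps [simp del]

text \<open>The restriction of \<open>a\<close> to the line x = 0 has order exactly \<open>n\<close>
  at the origin.\<close>

definition y_regular :: "nat \<Rightarrow> conv_series \<Rightarrow> bool" where
  "y_regular n a \<longleftrightarrow> conv_coeff a 0 n \<noteq> 0 \<and> (\<forall>j<n. conv_coeff a 0 j = 0)"

text \<open>A majorant argument with two different rates, \<open>A * T ^ i * S ^ j\<close>. The
  terms with \<open>k\<close> at least 1 involve y-indices up to \<open>j + n\<close>, which costs a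
  factor \<open>S ^ n\<close>; it is absorbed by choosing \<open>T\<close> after \<open>S\<close>,
  because these terms have a smaller x-index.\<close>

lemma weierstrass_quot_bound:
  fixes a g :: "nat \<Rightarrow> nat \<Rightarrow> complex"
  assumes an: "a 0 n \<noteq> 0"
    and a: "C > 0" "M \<ge> 1" "\<And>i j. norm (a i j) \<le> C * M ^ (i + j)"
    and g: "D > 0" "N \<ge> 1" "\<And>i j. norm (g i j) \<le> D * N ^ (i + j)"
  shows "\<exists>A R. 0 \<le> A \<and> 1 \<le> R \<and> (\<forall>i j. norm (weierstrass_quot n a g i j) \<le> A * R ^ (i + j))"
proof -
  \<comment> \<open>The recursion has three groups of terms; each is to use up at most one third of
    the bound.\<close>
  define e where "e = norm (a 0 n) / 3"
  have e: "e > 0" using an by (simp add: e_def)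
  \<comment> \<open>\<open>2 * M\<close> keeps the ratio \<open>M / S\<close> of the geometric sums
    below 1/2, \<open>N\<close> dominates the growth of \<open>g\<close>, and the last entry
    controls the terms of \<open>a\<close> on x = 0 beyond \<open>n\<close>. The same pattern gives
    \<open>T\<close>.\<close>
  define S where "S = Max {2 * M, N, 2 * C * M ^ (n + 1) / e}"
  have S: "S \<ge> 2 * M" "S \<ge> N" "S \<ge> 2 * C * M ^ (n + 1) / e"
    by (simp_all add: S_def)
  define T where "T = Max {2 * M, N, 4 * C * M * S ^ n / e}"
  have T: "T \<ge> 2 * M" "T \<ge> N" "T \<ge> 4 * C * M * S ^ n / e"
    by (simp_all add: T_def)
  have pos: "S > 0" "T > 0" "M > 0" using S T a by linarith+
  define A where "A = D * N ^ n / e"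
  have A: "A \<ge> 0" using e g by (simp add: A_def)
  define q where "q = weierstrass_quot n a g"
  have main: "norm (q i j) \<le> A * T ^ i * S ^ j" for i j
  proof (induction "(i, j)" arbitrary: i j rule: wf_induct_rule[OF wf_lex_prod[OF wf_less_than wf_less_than]])
    case (1 i j)
    then have IH: "norm (q i' j') \<le> A * T ^ i' * S ^ j'" if "i' < i \<or> i' = i \<and> j' < j" for i' j'
      using that by auto
    have t1: "norm (g i (j + n)) \<le> e * (A * T ^ i * S ^ j)"
    proof -
      have "norm (g i (j + n)) \<le> D * N ^ n * (N ^ i * N ^ j)"
        using g(3)[of i "j + n"] by (simp add: power_add mult_ac)
      also have "\<dots> \<le> D * N ^ n * (T ^ i * S ^ j)"
        by (intro mult_left_mono mult_mono power_mono) (use g S T pos in auto)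
      finally show ?thesis using e by (simp add: A_def)
    qed
    have t2: "norm (\<Sum>l\<in>{n+1..j+n}. a 0 l * q i (j + n - l)) \<le> e * (A * T ^ i * S ^ j)"
    proof -
      have "norm (\<Sum>l\<in>{n+1..j+n}. a 0 l * q i (j + n - l))
          = norm (\<Sum>m=1..j. a 0 (m + n) * q i (j - m))"
        by (rule arg_cong[where f = norm],
            rule sum.reindex_bij_witness[of _ "\<lambda>m. m + n" "\<lambda>l. l - n"]) auto
      also have "\<dots> \<le> (\<Sum>m=1..j. C * M ^ n * A * T ^ i * S ^ j * (M / S) ^ m)"
      proof (rule sum_norm_le)
        fix m assume m: "m \<in> {1..j}"
        have "norm (a 0 (m + n) * q i (j - m)) \<le> (C * M ^ (m + n)) * (A * T ^ i * S ^ (j - m))"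
          unfolding norm_mult by (intro mult_mono IH) (use a(3)[of 0 "m + n"] a m in auto)
        also have "\<dots> = C * M ^ n * A * T ^ i * S ^ j * (M / S) ^ m"
          using m pos by (simp add: power_add power_diff power_divide)
        finally show "norm (a 0 (m + n) * q i (j - m)) \<le> \<dots>" .
      qed
      also have "\<dots> = C * M ^ n * A * T ^ i * S ^ j * (\<Sum>m=1..j. (M / S) ^ m)"
        by (simp add: sum_distrib_left)
      also have "\<dots> \<le> C * M ^ n * A * T ^ i * S ^ j * (2 * (M / S))"
        by (intro mult_left_mono sum_geometric_le) (use a A pos S in \<open>auto simp: divide_simps\<close>)
      also have "\<dots> = (2 * C * M ^ (n + 1) / S) * (A * T ^ i * S ^ j)" by simp
      also have "\<dots> \<le> e * (A * T ^ i * S ^ j)"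
        by (intro mult_right_mono) (use A pos S e in \<open>auto simp: divide_simps mult_ac\<close>)
      finally show ?thesis .
    qed
    have t3: "norm (\<Sum>k\<in>{1..i}. \<Sum>l\<in>{..j+n}. a k l * q (i - k) (j + n - l)) \<le> e * (A * T ^ i * S ^ j)"
    proof -
      have "norm (\<Sum>k\<in>{1..i}. \<Sum>l\<in>{..j+n}. a k l * q (i - k) (j + n - l))
          \<le> (\<Sum>k\<in>{1..i}. \<Sum>l\<in>{..j+n}. C * A * T ^ i * S ^ (j + n) * (M / T) ^ k * (M / S) ^ l)"
      proof (intro sum_norm_le)
        fix k l assume kl: "k \<in> {1..i}" "l \<in> {..j+n}"
        have "norm (a k l * q (i - k) (j + n - l)) \<le> (C * M ^ (k + l)) * (A * T ^ (i - k) * S ^ (j + n - l))"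
          unfolding norm_mult by (intro mult_mono IH a(3)) (use a kl in auto)
        also have "\<dots> = C * A * T ^ i * S ^ (j + n) * (M / T) ^ k * (M / S) ^ l"
          using kl pos by (simp add: power_add[of M] power_diff power_divide)
        finally show "norm (a k l * q (i - k) (j + n - l)) \<le> \<dots>" .
      qed
      also have "\<dots> = C * A * T ^ i * S ^ (j + n) * ((\<Sum>k=1..i. (M / T) ^ k) * (\<Sum>l\<le>j+n. (M / S) ^ l))"
        by (subst sum_product) (simp only: sum_distrib_left mult.assoc)
      also have "\<dots> \<le> C * A * T ^ i * S ^ (j + n) * ((2 * (M / T)) * 2)"
        by (intro mult_left_mono mult_mono sum_geometric_le)
          (use a A pos S T in \<open>auto simp: divide_simps intro!: sum_nonneg\<close>)
      also have "\<dots> = (4 * C * M * S ^ n / T) * (A * T ^ i * S ^ j)" by (simp add: power_add)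
      also have "\<dots> \<le> e * (A * T ^ i * S ^ j)"
        by (intro mult_right_mono) (use A pos T e in \<open>auto simp: divide_simps mult_ac\<close>)
      finally show ?thesis .
    qed
    have "norm (q i j) * (3 * e) = norm (g i (j + n) - (\<Sum>l\<in>{n+1..j+n}. a 0 l * q i (j + n - l))
       - (\<Sum>k\<in>{1..i}. \<Sum>l\<in>{..j+n}. a k l * q (i - k) (j + n - l)))"
      unfolding q_def by (subst weierstrass_quot.simps) (use an in \<open>simp add: norm_divide e_def\<close>)
    also have "\<dots> \<le> 3 * e * (A * T ^ i * S ^ j)"
      by (rule order_trans[OF norm_triangle_ineq4], rule order_trans[OF add_mono[OF order_trans[OF norm_triangle_ineq4 add_mono[OF t1 t2]] t3]])
        simp
    finally show ?case using e by simp
  qed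
  define R where "R = max S T"
  have "norm (q i j) \<le> A * R ^ (i + j)" for i j
  proof -
    have "A * (T ^ i * S ^ j) \<le> A * (R ^ i * R ^ j)"
      by (intro mult_left_mono mult_mono power_mono) (use A pos in \<open>auto simp: R_def\<close>)
    then show ?thesis using main[of i j] by (simp add: power_add mult_ac)
  qed
  moreover have "R \<ge> 1" using S a by (auto simp: R_def)
  ultimately show ?thesis using A unfolding q_def by blast
qed

text \<open>The quotient is the series with the recursively defined coefficients: the recursion says
  precisely that \<open>g - a * q\<close> has no terms of degree \<open>n\<close> or more in
  y.\<close>

theorem weierstrass_division:
  assumes "y_regular n a"
  obtains q r where "g = a * q + r" "\<And>i j. j \<ge> n \<Longrightarrow> conv_coeff r i j = 0"
proof -
  obtain C M where a: "C > 0" "M \<ge> 1" "\<And>i j. norm (conv_coeff a i j) \<le> C * M ^ (i + j)"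
    by (rule conv_coeff_bound[of a]) (rule that)
  obtain D N where g: "D > 0" "N \<ge> 1" "\<And>i j. norm (conv_coeff g i j) \<le> D * N ^ (i + j)"
    by (rule conv_coeff_bound[of g]) (rule that)
  have an: "conv_coeff a 0 n \<noteq> 0" and a0: "\<And>j. j < n \<Longrightarrow> conv_coeff a 0 j = 0"
    using assms by (auto simp: y_regular_def)
  obtain q where q: "\<And>i j. conv_coeff q i j = weierstrass_quot n (conv_coeff a) (conv_coeff g) i j"
  proof -
    obtain A R where "0 \<le> A" "1 \<le> R"
        "\<And>i j. norm (weierstrass_quot n (conv_coeff a) (conv_coeff g) i j) \<le> A * R ^ (i + j)"
      using weierstrass_quot_bound[OF an a g] by blast
    then show ?thesis by (rule conv_series_exists) (rule that)
  qed
  have "conv_coeff (g - a * q) i j = 0" if "j \<ge> n" for i j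
  proof -
    obtain j' where j: "j = j' + n" using \<open>j \<ge> n\<close> by (metis le_add_diff_inverse2)
    \<comment> \<open>For \<open>k = 0\<close> the coefficients of \<open>a\<close> below
      \<open>n\<close> vanish, so \<open>q i j'\<close> is the only unknown here of y-index
      \<open>j'\<close> or more.\<close>
    have low: "(\<Sum>l\<le>j. conv_coeff a 0 l * conv_coeff q i (j - l))
        = conv_coeff a 0 n * conv_coeff q i j'
          + (\<Sum>l\<in>{n+1..j'+n}. conv_coeff a 0 l * conv_coeff q i (j' + n - l))"
    proof -
      have "(\<Sum>l\<le>j. conv_coeff a 0 l * conv_coeff q i (j - l))
          = (\<Sum>l\<in>{n..j'+n}. conv_coeff a 0 l * conv_coeff q i (j' + n - l))"
        by (rule sum.mono_neutral_cong_right) (auto simp: j a0)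
      also have "{n..j'+n} = insert n {n+1..j'+n}" by auto
      finally show ?thesis by simp
    qed
    have "conv_coeff (a * q) i j
       = (\<Sum>l\<le>j. conv_coeff a 0 l * conv_coeff q i (j - l))
         + (\<Sum>k\<in>{1..i}. \<Sum>l\<le>j. conv_coeff a k l * conv_coeff q (i - k) (j - l))"
    proof -
      have "{..i} = insert 0 {1..i}" by auto
      then show ?thesis by (simp add: conv_coeff_mult)
    qed
    also have "\<dots> = conv_coeff g i j"
    proof -
      have "conv_coeff a 0 n * conv_coeff q i j' = conv_coeff g i (j' + n)
          - (\<Sum>l\<in>{n+1..j'+n}. conv_coeff a 0 l * conv_coeff q i (j' + n - l))
          - (\<Sum>k\<in>{1..i}. \<Sum>l\<in>{..j'+n}. conv_coeff a k l * conv_coeff q (i - k) (j' + n - l))"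
        unfolding q using an by (subst weierstrass_quot.simps) (simp only: nonzero_mult_div_cancel_left times_divide_eq_right not_False_eq_True simp_thms)
      then show ?thesis unfolding low unfolding j by (simp only: diff_diff_eq add.assoc diff_add_cancel)
    qed
    finally show ?thesis by simp
  qed
  then show ?thesis by (intro that[of q "g - a * q"]) auto
qed

section \<open>Evaluation near the origin\<close>

definition eval_term :: "conv_series \<Rightarrow> complex \<times> complex \<Rightarrow> nat \<times> nat \<Rightarrow> complex" where
  "eval_term a z = (\<lambda>(i, j). conv_coeff a i j * fst z ^ i * snd z ^ j)"

lemma conv_eval_eq: "conv_eval a z = infsum (eval_term a z) UNIV"
  by (simp add: conv_eval_def eval_term_def)

definition polydisc :: "real \<Rightarrow> (complex \<times> complex) set" where
  "polydisc d = {z. norm (fst z) \<le> d \<and> norm (snd z) \<le> d}"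

text \<open>Absolute convergence at the corner \<open>(d, d)\<close> dominates the terms at all
  points of \<open>polydisc d\<close> simultaneously, hence uniformly.\<close>

definition conv_on :: "real \<Rightarrow> conv_series \<Rightarrow> bool" where
  "conv_on d a \<longleftrightarrow> (\<lambda>(i, j). norm (conv_coeff a i j) * (d ^ i * d ^ j)) summable_on UNIV"

lemma eventually_polydisc:
  assumes "eventually P (nhds (0 :: complex \<times> complex))"
  shows "\<exists>d>0. \<forall>z\<in>polydisc d. P z"
proof -
  obtain e where e: "e > 0" "\<And>z. dist z 0 < e \<Longrightarrow> P z"
    using assms by (auto simp: eventually_nhds_metric)
  have "P z" if "z \<in> polydisc (e / 4)" for z
  proof (rule e(2))
    have "dist z 0 \<le> norm (fst z) + norm (snd z)"
      using norm_Pair_le[of "fst z" "snd z"] by simp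
    also have "\<dots> < e" using that e(1) by (auto simp: polydisc_def)
    finally show "dist z 0 < e" .
  qed
  then show ?thesis using e(1) by (intro exI[of _ "e / 4"]) auto
qed

lemma polydisc_eventually:
  assumes "d > 0"
  shows "eventually (\<lambda>z. z \<in> polydisc d) (nhds 0)"
proof -
  have "z \<in> polydisc d" if "dist z 0 < d" for z
    using that norm_fst_le[of "fst z" "snd z"] norm_snd_le[of "snd z" "fst z"] by (auto simp: polydisc_def)
  then show ?thesis using assms by (auto simp: eventually_nhds_metric)
qed

lemma conv_on_exists: "\<exists>d>0. conv_on d a"
  using fps_of_conv[of a] by (auto simp: fps2_convergent_def conv_on_def conv_coeff.rep_eq)

lemma conv_on_mono:
  assumes "conv_on d a" "0 \<le> d'" "d' \<le> d"
  shows "conv_on d' a"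
  unfolding conv_on_def
  by (rule summable_on_comparison_test[OF assms(1)[unfolded conv_on_def]])
     (use assms in \<open>auto intro!: mult_left_mono mult_mono power_mono\<close>)

lemma norm_eval_term_le:
  assumes "z \<in> polydisc d"
  shows "norm (eval_term a z (i, j)) \<le> norm (conv_coeff a i j) * (d ^ i * d ^ j)"
proof -
  have "d \<ge> 0" using assms norm_ge_zero[of "fst z"] by (auto simp: polydisc_def simp del: norm_ge_zero)
  then show ?thesis
    using assms by (auto simp: eval_term_def norm_mult norm_power mult.assoc polydisc_def
      intro!: mult_left_mono mult_mono power_mono)
qed

lemma eval_term_summable:
  assumes "conv_on d a" "z \<in> polydisc d"
  shows "(\<lambda>p. norm (eval_term a z p)) summable_on UNIV" "eval_term a z summable_on UNIV"
proof -
  show 1: "(\<lambda>p. norm (eval_term a z p)) summable_on UNIV"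
    by (rule summable_on_comparison_test[OF assms(1)[unfolded conv_on_def]])
       (use norm_eval_term_le[OF assms(2)] in auto)
  then show "eval_term a z summable_on UNIV" by (rule abs_summable_summable)
qed

lemma conv_eval_add:
  assumes "conv_on d a" "conv_on d b" "z \<in> polydisc d"
  shows "conv_eval (a + b) z = conv_eval a z + conv_eval b z"
proof -
  have "eval_term (a + b) z = (\<lambda>p. eval_term a z p + eval_term b z p)"
    by (auto simp: eval_term_def algebra_simps)
  then show ?thesis
    using eval_term_summable[OF assms(1,3)] eval_term_summable[OF assms(2,3)]
    by (simp add: conv_eval_eq infsum_add)
qed

text \<open>Cauchy product: the family of products of terms is absolutely summable, so it may be
  regrouped by the total exponent.\<close>

lemma conv_eval_mult:
  assumes "conv_on d a" "conv_on d b" "z \<in> polydisc d"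
  shows "conv_eval (a * b) z = conv_eval a z * conv_eval b z"
proof -
  define s where "s = eval_term a z"
  define t where "t = eval_term b z"
  note st = eval_term_summable[OF assms(1,3), folded s_def] eval_term_summable[OF assms(2,3), folded t_def]
  have "(\<lambda>pq. norm ((\<lambda>(p, q). s p * t q) pq)) summable_on UNIV \<times> UNIV"
    unfolding Infinite_Sum.abs_summable_on_Sigma_iff
    using st by (auto simp: norm_mult infsum_cmult_right' abs_mult infsum_nonneg
        intro!: summable_on_cmult_left summable_on_cmult_right)
  then have sm: "(\<lambda>(p, q). s p * t q) summable_on UNIV \<times> UNIV"
    by (rule abs_summable_summable)
  then have "infsum (\<lambda>(p, q). s p * t q) (UNIV \<times> UNIV) = (\<Sum>\<^sub>\<infinity>p. \<Sum>\<^sub>\<infinity>q. s p * t q)"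
    by (simp add: infsum_Sigma'_banach)
  also have "\<dots> = conv_eval a z * conv_eval b z"
    using st by (simp add: infsum_cmult_right infsum_cmult_left conv_eval_eq s_def t_def)
  finally have "((\<lambda>(p, q). s p * t q) has_sum conv_eval a z * conv_eval b z) (UNIV \<times> UNIV)"
    using sm by (simp add: has_sum_iff)
  \<comment> \<open>The new index consists of the total exponent and the exponent taken from the
    first factor.\<close>
  also have "?this \<longleftrightarrow> ((\<lambda>((i, j), (k, l)). s (k, l) * t (i - k, j - l)) has_sum conv_eval a z * conv_eval b z)
      (Sigma UNIV (\<lambda>(i, j). {..i} \<times> {..j}))"
    by (rule has_sum_reindex_bij_witness[of _ "\<lambda>((i, j), (k, l)). ((k, l), (i - k, j - l))"
          "\<lambda>((k, l), (i, j)). ((k + i, l + j), (k, l))"]) auto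
  finally have "((\<lambda>(i, j). \<Sum>(k, l)\<in>{..i} \<times> {..j}. s (k, l) * t (i - k, j - l)) has_sum
      conv_eval a z * conv_eval b z) UNIV"
    by (rule has_sum_SigmaD) (auto intro!: has_sum_finiteI sum.cong)
  also have "(\<lambda>(i, j). \<Sum>(k, l)\<in>{..i} \<times> {..j}. s (k, l) * t (i - k, j - l)) = eval_term (a * b) z"
  proof (intro ext, clarify)
    fix i j
    have "(\<Sum>(k, l)\<in>{..i} \<times> {..j}. s (k, l) * t (i - k, j - l))
       = (\<Sum>k\<le>i. \<Sum>l\<le>j. conv_coeff a k l * conv_coeff b (i - k) (j - l) * (fst z ^ i * snd z ^ j))"
      unfolding sum.cartesian_product
    proof (rule sum.cong, simp, clarify)
      fix k l assume "k \<le> i" "l \<le> j"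
      then have "fst z ^ i = fst z ^ k * fst z ^ (i - k)" "snd z ^ j = snd z ^ l * snd z ^ (j - l)"
        by (simp_all flip: power_add)
      then show "s (k, l) * t (i - k, j - l) =
          conv_coeff a k l * conv_coeff b (i - k) (j - l) * (fst z ^ i * snd z ^ j)"
        by (simp add: s_def t_def eval_term_def mult_ac)
    qed
    also have "\<dots> = eval_term (a * b) z (i, j)"
      by (simp add: conv_coeff_mult eval_term_def sum_distrib_right mult.assoc)
    finally show "(\<Sum>(k, l)\<in>{..i} \<times> {..j}. s (k, l) * t (i - k, j - l)) = eval_term (a * b) z (i, j)" .
  qed
  finally show ?thesis by (simp add: has_sum_iff conv_eval_eq)
qed

lemma conv_eval_continuous:
  assumes "conv_on d a"
  shows "continuous_on (polydisc d) (conv_eval a)"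
proof -
  have "uniform_limit (polydisc d) (\<lambda>X z. \<Sum>p\<in>X. eval_term a z p) (\<lambda>z. infsum (eval_term a z) UNIV)
      (finite_subsets_at_top UNIV)"
    by (rule Weierstrass_m_test_general[OF _ assms[unfolded conv_on_def]])
       (use norm_eval_term_le in auto)
  then have "continuous_on (polydisc d) (\<lambda>z. infsum (eval_term a z) UNIV)"
  proof (rule uniform_limit_theorem[rotated])
    show "\<forall>\<^sub>F X in finite_subsets_at_top UNIV. continuous_on (polydisc d) (\<lambda>z. \<Sum>p\<in>X. eval_term a z p)"
      by (intro always_eventually allI continuous_on_sum)
         (auto simp: eval_term_def intro!: continuous_intros)
  qed auto
  then show ?thesis by (simp add: conv_eval_eq [abs_def])
qed

section \<open>Restriction to vertical lines\<close>

definition y_coeff :: "conv_series \<Rightarrow> nat \<Rightarrow> complex fps" where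
  "y_coeff a j = Abs_fps (\<lambda>i. conv_coeff a i j)"

text \<open>At the point \<open>(d, d)\<close> the terms with fixed \<open>j\<close> form a
  subfamily of a summable family; cancelling \<open>d ^ j\<close> leaves the series in x at
  \<open>d\<close>.\<close>

lemma y_coeff_conv_radius: "fps_conv_radius (y_coeff a j) > 0"
proof -
  obtain d where d: "d > 0" "conv_on d a" using conv_on_exists by blast
  have "(of_real d, of_real d) \<in> polydisc d" using d by (simp add: polydisc_def)
  then have "eval_term a (of_real d, of_real d) summable_on range (\<lambda>i. (i, j))"
    using summable_on_subset_banach[OF eval_term_summable(2)[OF d(2)]] by blast
  then have "(eval_term a (of_real d, of_real d) \<circ> (\<lambda>i. (i, j))) summable_on UNIV"
    by (subst (asm) summable_on_reindex) (auto simp: inj_on_def)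
  then have "(\<lambda>i. conv_coeff a i j * of_real d ^ i * of_real d ^ j) summable_on UNIV"
    by (simp add: eval_term_def o_def)
  then have "(\<lambda>i. conv_coeff a i j * of_real d ^ i) summable_on UNIV"
    using d by (subst (asm) summable_on_cmult_left') auto
  then have "ereal (norm (complex_of_real d)) \<le> conv_radius (\<lambda>i. conv_coeff a i j)"
    by (intro conv_radius_geI summable_on_imp_summable)
  then have "ereal d \<le> fps_conv_radius (y_coeff a j)"
    using d by (simp add: fps_conv_radius_def y_coeff_def)
  then show ?thesis using d(1) by (meson ereal_less(2) less_le_trans)
qed

text \<open>With bounded degree in y the double sum becomes a finite sum of series in x, so on a
  vertical line the function is a polynomial in y.\<close>

lemma conv_eval_expand:
  assumes "conv_on d a" "(x, y) \<in> polydisc d" "\<And>i j. j \<ge> n \<Longrightarrow> conv_coeff a i j = 0"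
    and x: "\<And>j. j < n \<Longrightarrow> ereal (norm x) < fps_conv_radius (y_coeff a j)"
  shows "conv_eval a (x, y) = (\<Sum>j<n. eval_fps (y_coeff a j) x * y ^ j)"
proof -
  have sm: "eval_term a (x, y) summable_on UNIV"
    by (rule eval_term_summable[OF assms(1,2)])
  have hs: "(eval_term a (x, y) has_sum conv_eval a (x, y)) UNIV"
    using sm by (simp add: conv_eval_eq)
  also have "?this \<longleftrightarrow> (eval_term a (x, y) has_sum conv_eval a (x, y)) (UNIV \<times> {..<n})"
  proof (rule has_sum_cong_neutral)
    fix p :: "nat \<times> nat"
    assume "p \<in> UNIV - UNIV \<times> {..<n}"
    then show "eval_term a (x, y) p = 0"
      by (cases p) (simp add: eval_term_def assms(3))
  qed auto
  also have "\<dots> \<longleftrightarrow> ((\<lambda>(j, i). eval_term a (x, y) (i, j)) has_sum conv_eval a (x, y)) ({..<n} \<times> UNIV)"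
    by (rule has_sum_reindex_bij_witness[of _ prod.swap prod.swap]) auto
  finally have hs': "((\<lambda>(j, i). eval_term a (x, y) (i, j)) has_sum conv_eval a (x, y)) ({..<n} \<times> UNIV)" .
  have "((\<lambda>j. eval_fps (y_coeff a j) x * y ^ j) has_sum conv_eval a (x, y)) {..<n}"
  proof (rule has_sum_SigmaD[OF hs'])
    fix j assume j: "j \<in> {..<n}"
    have "summable (\<lambda>i. norm (conv_coeff a i j * x ^ i))"
      using j x[of j] by (intro abs_summable_in_conv_radius) (simp_all add: fps_conv_radius_def y_coeff_def)
    then have "((\<lambda>i. conv_coeff a i j * x ^ i) has_sum (\<Sum>i. conv_coeff a i j * x ^ i)) UNIV"
      by (intro norm_summable_imp_has_sum summable_sums) (auto dest: summable_norm_cancel)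
    then show "((\<lambda>i. case (j, i) of (j, i) \<Rightarrow> eval_term a (x, y) (i, j)) has_sum
        eval_fps (y_coeff a j) x * y ^ j) UNIV"
      by (auto simp: eval_term_def eval_fps_def y_coeff_def intro!: has_sum_cmult_left)
  qed
  then show ?thesis by (metis finite_lessThan has_sum_finite has_sum_unique)
qed

lemma eventually_less_fps_conv_radius:
  fixes F :: "complex fps"
  assumes "fps_conv_radius F > 0"
  shows "\<forall>\<^sub>F x in at 0. ereal (norm x) < fps_conv_radius F"
proof -
  have "\<forall>\<^sub>F x in at 0. x \<in> eball 0 (fps_conv_radius F)"
    using assms by (intro eventually_at_in_open'[of "eball 0 (fps_conv_radius F)"]) (auto simp: zero_ereal_def)
  then show ?thesis by eventually_elim (simp add: in_eball_iff)
qed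

lemma eval_fps_tendsto_0:
  fixes F :: "complex fps"
  assumes "fps_conv_radius F > 0"
  shows "(eval_fps F \<longlongrightarrow> fps_nth F 0) (at 0)"
proof -
  have "continuous_on (eball 0 (fps_conv_radius F)) (eval_fps F)"
    by (rule continuous_on_eval_fps)
  then have "isCont (eval_fps F) 0"
    using assms by (subst (asm) continuous_on_eq_continuous_at) (auto simp: zero_ereal_def)
  then show ?thesis by (simp add: isCont_def eval_fps_at_0)
qed

text \<open>After the lowest power of the variable is split off, the other factor is nonzero at 0
  and, by continuity, nearby.\<close>

lemma eval_fps_eventually_nonzero:
  fixes F :: "complex fps"
  assumes "F \<noteq> 0" "fps_conv_radius F > 0"
  shows "\<forall>\<^sub>F x in at 0. eval_fps F x \<noteq> 0"
proof -
  define k where "k = subdegree F"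
  define G where "G = fps_shift k F"
  have F: "F = fps_X ^ k * G"
    by (simp add: G_def k_def subdegree_decompose mult.commute)
  have G: "fps_conv_radius G > 0" using assms by (simp add: G_def)
  have "fps_nth G 0 \<noteq> 0" using assms by (simp add: G_def k_def)
  then have "\<forall>\<^sub>F x in at 0. eval_fps G x \<noteq> 0"
    by (rule tendsto_imp_eventually_ne[OF eval_fps_tendsto_0[OF G]])
  moreover have "\<forall>\<^sub>F x in at 0. ereal (norm x) < fps_conv_radius G"
    by (rule eventually_less_fps_conv_radius[OF G])
  moreover have "\<forall>\<^sub>F x in at 0. x \<noteq> (0 :: complex)" by (simp add: eventually_at_filter)
  ultimately show ?thesis
  proof eventually_elim
    case (elim x)
    then show ?case
      unfolding F by (subst eval_fps_mult) (auto simp: eval_fps_power)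
  qed
qed

text \<open>Induction on the degree of \<open>P\<close>: a root of \<open>P\<close> lies in
  \<open>U\<close>, where \<open>s\<close> does not vanish at it, so it is also a root of
  \<open>Q\<close> and can be cancelled from both.\<close>

lemma complex_poly_dvd_if_local:
  fixes P Q :: "complex poly"
  assumes "open U" "continuous_on U s" "continuous_on U t"
    and "\<And>y. y \<in> U \<Longrightarrow> s y * poly Q y = poly P y * t y"
    and "\<And>y. poly P y = 0 \<Longrightarrow> y \<in> U \<and> s y \<noteq> 0" and "P \<noteq> 0"
  shows "P dvd Q"
  using assms(4-)
proof (induction "degree P" arbitrary: P Q)
  case 0
  then show ?case by (metis is_unit_iff_degree unit_imp_dvd)
next
  case (Suc m)
  have "\<not> constant (poly P)" using Suc.hyps by (simp add: constant_degree)
  then obtain y0 where y0: "poly P y0 = 0" using fundamental_theorem_of_algebra by blast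
  then have y0U: "y0 \<in> U" "s y0 \<noteq> 0" using Suc.prems by auto
  obtain P1 where P1: "P = [:- y0, 1:] * P1" using y0 poly_eq_0_iff_dvd by blast
  have "poly Q y0 = 0" using Suc.prems(1)[OF y0U(1)] y0U y0 by simp
  then obtain Q1 where Q1: "Q = [:- y0, 1:] * Q1" using poly_eq_0_iff_dvd by blast
  have P1n: "P1 \<noteq> 0" using Suc.prems P1 by auto
  have deg: "m = degree P1"
    using Suc.hyps(2) P1n unfolding P1 by (subst (asm) degree_mult_eq) auto
  have off: "s y * poly Q1 y = poly P1 y * t y" if "y \<in> U" "y \<noteq> y0" for y
  proof -
    have "(y - y0) * (s y * poly Q1 y) = (y - y0) * (poly P1 y * t y)"
      using Suc.prems(1)[OF that(1)] by (simp add: P1 Q1 algebra_simps)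
    then show ?thesis using that(2) by simp
  qed
  \<comment> \<open>The cancelled identity holds away from \<open>y0\<close> only; \<open>F\<close>
    is its defect, and continuity extends it to \<open>y0\<close>.\<close>
  define F where "F = (\<lambda>y. s y * poly Q1 y - poly P1 y * t y)"
  have "continuous_on U F" unfolding F_def using assms by (intro continuous_intros) auto
  then have cont: "(F \<longlongrightarrow> F y0) (at y0)"
    using y0U assms(1) by (simp add: continuous_on_eq_continuous_at isCont_def)
  have "\<forall>\<^sub>F y in at y0. F y = 0"
    using eventually_at_in_open[OF assms(1) y0U(1)] by eventually_elim (use off in \<open>auto simp: F_def\<close>)
  then have "(F \<longlongrightarrow> 0) (at y0)" by (rule tendsto_eventually)
  then have "F y0 = 0" using cont tendsto_unique trivial_limit_at by blast
  then have "s y * poly Q1 y = poly P1 y * t y" if "y \<in> U" for y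
    using off that by (cases "y = y0") (auto simp: F_def)
  moreover have "y \<in> U \<and> s y \<noteq> 0" if "poly P1 y = 0" for y
    using Suc.prems(2)[of y] that by (simp add: P1)
  ultimately have "P1 dvd Q1" using Suc.hyps(1)[OF deg] P1n by blast
  then show ?case unfolding P1 Q1 by (intro mult_dvd_mono) auto
qed

text \<open>Away from 0 the leading term outweighs all the others together, whatever the individual
  small coefficients are; hence one \<open>\<eta>\<close> serves all polynomials of degree
  \<open>n\<close>.\<close>

lemma monic_root_small:
  assumes "\<epsilon> > 0"
  shows "\<exists>\<eta>>0. \<forall>c y. (\<forall>j<n. norm (c j :: complex) < \<eta>) \<longrightarrow> y ^ n + (\<Sum>j<n. c j * y ^ j) = 0 \<longrightarrow> norm y < \<epsilon>"
proof -
  define e where "e = min \<epsilon> 1"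
  have e: "e > 0" "e \<le> 1" "e \<le> \<epsilon>" using assms by (auto simp: e_def)
  define \<eta> where "\<eta> = e ^ n / (n + 1)"
  have \<eta>: "\<eta> > 0" "n * \<eta> < e ^ n" "n * \<eta> < 1"
  proof -
    show "\<eta> > 0" using e by (simp add: \<eta>_def)
    show "n * \<eta> < e ^ n" using e by (simp add: \<eta>_def field_simps)
    moreover have "e ^ n \<le> 1" using e by (simp add: power_le_one)
    ultimately show "n * \<eta> < 1" by linarith
  qed
  have "norm y < \<epsilon>" if c: "\<forall>j<n. norm (c j) < \<eta>" and 0: "y ^ n + (\<Sum>j<n. c j * y ^ j) = 0"
    for c and y :: complex
  proof (rule ccontr)
    assume "\<not> norm y < \<epsilon>"
    then have y: "norm y \<ge> e" using e by auto
    \<comment> \<open>A common bound for the lower powers of \<open>norm y\<close>, valid both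
      inside and outside the unit disc.\<close>
    define M where "M = max 1 (norm y ^ n)"
    have "norm y ^ j \<le> M" if "j < n" for j
    proof (cases "norm y \<ge> 1")
      case True
      then have "norm y ^ j \<le> norm y ^ n" using that by (intro power_increasing) auto
      then show ?thesis by (simp add: M_def)
    next
      case False
      then have "norm y ^ j \<le> 1" by (simp add: power_le_one)
      then show ?thesis by (simp add: M_def)
    qed
    then have "norm (\<Sum>j<n. c j * y ^ j) \<le> (\<Sum>j<n. \<eta> * M)"
      by (intro sum_norm_le) (use c \<eta> in \<open>auto simp: norm_mult norm_power less_imp_le intro!: mult_mono\<close>)
    moreover have yn: "y ^ n = - (\<Sum>j<n. c j * y ^ j)" using 0 by (simp add: eq_neg_iff_add_eq_0)
    ultimately have le: "norm y ^ n \<le> n * \<eta> * M"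
      unfolding norm_power[symmetric] yn norm_minus_cancel by simp
    have en: "e ^ n \<le> norm y ^ n" using y e by (intro power_mono) auto
    show False
    proof (cases "norm y ^ n \<ge> 1")
      case True
      then have M: "M = norm y ^ n" by (simp add: M_def)
      have "n * \<eta> * M < 1 * M" by (rule mult_strict_right_mono) (use \<eta> True M in auto)
      then show False using le M by simp
    next
      case False
      then have "M = 1" by (simp add: M_def)
      then show False using le en \<eta> by simp
    qed
  qed
  then show ?thesis using \<eta> by blast
qed

text \<open>The filter \<open>at 0\<close> leaves out the origin, so pairs without any common zero
  near 0, such as those containing a unit, are included.\<close>

definition isolated_common_zero :: "conv_series \<Rightarrow> conv_series \<Rightarrow> bool" where
  "isolated_common_zero a b \<longleftrightarrow> (\<forall>\<^sub>F z in at 0. \<not> (conv_eval a z = 0 \<and> conv_eval b z = 0))"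

lemma conv_on_common:
  assumes "finite S"
  shows "\<exists>d>0. \<forall>a\<in>S. conv_on d a"
  using assms
proof (induction S)
  case empty
  then show ?case by (intro exI[of _ 1]) auto
next
  case (insert a S)
  then obtain d where d: "d > 0" "\<forall>a\<in>S. conv_on d a" by blast
  obtain e where e: "e > 0" "conv_on e a" using conv_on_exists by blast
  show ?case
    using conv_on_mono[OF e(2), of "min d e"] conv_on_mono[of d _ "min d e"] d e
    by (intro exI[of _ "min d e"]) auto
qed

text \<open>Near the origin a common zero of \<open>a\<close> and \<open>b\<close> is also one of
  any two combinations of them.\<close>

lemma isolated_common_zero_combination:
  assumes "isolated_common_zero (p * a + q * b) (p' * a + q' * b)"
  shows "isolated_common_zero a b"
proof -
  \<comment> \<open>The products are listed as well, because additivity of evaluation is applied to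
    them as summands.\<close>
  obtain d where d: "d > 0" "\<forall>s\<in>{a, b, p, q, p', q', p * a, q * b, p' * a, q' * b}. conv_on d s"
    using conv_on_common[of "{a, b, p, q, p', q', p * a, q * b, p' * a, q' * b}"] by blast
  have "eventually (\<lambda>z. z \<in> polydisc d) (at (0 :: complex \<times> complex))"
    using polydisc_eventually[OF d(1)] by (simp add: eventually_at_filter eventually_mono)
  with assms show ?thesis
    unfolding isolated_common_zero_def
  proof eventually_elim
    case (elim z)
    have "conv_eval (u * a + v * b) z = conv_eval u z * conv_eval a z + conv_eval v z * conv_eval b z"
      if "conv_on d u" "conv_on d v" "conv_on d (u * a)" "conv_on d (v * b)" for u v
      using that d(2) elim(2) by (simp add: conv_eval_add conv_eval_mult)
    from this[of p q] this[of p' q'] show ?case using elim(1) d(2) by auto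
  qed
qed

lemma isolated_common_zero_commute: "isolated_common_zero a b \<longleftrightarrow> isolated_common_zero b a"
  by (simp add: isolated_common_zero_def conj_commute)

text \<open>If neither series were regular in y, both would vanish on the whole line x = 0, which
  contains common zeros arbitrarily close to the origin.\<close>

lemma isolated_common_zero_y_regular:
  assumes "isolated_common_zero a b"
  obtains n where "y_regular n a \<or> y_regular n b"
proof (cases "\<exists>j. conv_coeff a 0 j \<noteq> 0 \<or> conv_coeff b 0 j \<noteq> 0")
  case True
  define n where "n = (LEAST j. conv_coeff a 0 j \<noteq> 0 \<or> conv_coeff b 0 j \<noteq> 0)"
  have "conv_coeff a 0 n \<noteq> 0 \<or> conv_coeff b 0 n \<noteq> 0"
    unfolding n_def using True by (rule LeastI_ex)
  moreover have "conv_coeff a 0 j = 0 \<and> conv_coeff b 0 j = 0" if "j < n" for j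
    using not_less_Least[OF that[unfolded n_def]] by blast
  ultimately show ?thesis using that unfolding y_regular_def by blast
next
  case False
  have zero: "conv_eval c (0, y) = 0" if "\<And>j. conv_coeff c 0 j = 0" for c y
  proof -
    have "eval_term c (0, y) = (\<lambda>_. 0)"
      using that by (auto simp: eval_term_def fun_eq_iff power_0_left)
    then show ?thesis by (simp add: conv_eval_eq)
  qed
  obtain e where e: "e > 0" "\<And>z. z \<noteq> 0 \<Longrightarrow> dist z 0 < e \<Longrightarrow> \<not> (conv_eval a z = 0 \<and> conv_eval b z = 0)"
    using assms by (auto simp: isolated_common_zero_def eventually_at)
  have "\<not> (conv_eval a (0, of_real (e / 2)) = 0 \<and> conv_eval b (0, of_real (e / 2)) = 0)"
    by (rule e(2)) (use e(1) in \<open>auto simp: zero_prod_def dist_Pair_Pair\<close>)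
  then show ?thesis using False zero by simp
qed

section \<open>Isolated common zeros and regular pairs\<close>

lemma poly_sum_monom:
  fixes y :: "'a :: comm_semiring_1"
  shows "poly (\<Sum>j<n. monom (c j) j) y = (\<Sum>j<n. c j * y ^ j)"
  by (simp add: poly_sum poly_monom)

lemma coeff_sum_monom: "coeff (\<Sum>j<n. monom (c j) j) k = (if k < n then c k else 0)"
  by (simp add: coeff_sum)

text \<open>On a vertical line close to \<open>x = 0\<close> all \<open>n\<close> roots of the Weierstrass polynomial \<open>A\<close> are
  close to \<open>0\<close>, where \<open>b\<close> does not vanish on them; so \<open>A\<close> divides \<open>r\<close> there, although
  \<open>r\<close> has smaller degree.\<close>

lemma weierstrass_poly_remainder_zero:
  assumes iso: "isolated_common_zero A b"
    and A: "\<And>i j. j > n \<Longrightarrow> conv_coeff A i j = 0"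
      "\<And>i. conv_coeff A i n = (if i = 0 then 1 else 0)"
      "\<And>j. j < n \<Longrightarrow> conv_coeff A 0 j = 0"
    and r: "\<And>i j. j \<ge> n \<Longrightarrow> conv_coeff r i j = 0"
    and eq: "b * r = A * t"
  shows "r = 0"
proof -
  obtain d0 where d0: "d0 > 0" "\<forall>s\<in>{A, b, r, t}. conv_on d0 s"
    using conv_on_common[of "{A, b, r, t}"] by blast
  have "\<forall>\<^sub>F z in nhds 0. z \<noteq> 0 \<longrightarrow> \<not> (conv_eval A z = 0 \<and> conv_eval b z = 0)"
    using iso by (simp add: isolated_common_zero_def eventually_at_filter)
  then obtain d1 where d1: "d1 > 0"
      "\<forall>z\<in>polydisc d1. z \<noteq> 0 \<longrightarrow> \<not> (conv_eval A z = 0 \<and> conv_eval b z = 0)"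
    using eventually_polydisc by blast
  define d where "d = min d0 d1"
  have d: "d > 0" using d0 d1 by (simp add: d_def)
  have on: "conv_on d A" "conv_on d b" "conv_on d r" "conv_on d t"
    using d0 d by (auto simp: d_def intro: conv_on_mono)
  have isod: "\<not> (conv_eval A z = 0 \<and> conv_eval b z = 0)" if "z \<in> polydisc d" "z \<noteq> 0" for z
  proof -
    have "z \<in> polydisc d1" using that(1) by (auto simp: polydisc_def d_def)
    then show ?thesis using d1(2) that(2) by blast
  qed
  \<comment> \<open>Lower coefficients smaller than \<open>\<eta>\<close> force all roots on the
    line into the disc of radius \<open>d\<close>, where the power series may be evaluated.\<close>
  obtain \<eta> where \<eta>: "\<eta> > 0" "\<And>c y. (\<And>j. j < n \<Longrightarrow> norm (c j :: complex) < \<eta>) \<Longrightarrow>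
      y ^ n + (\<Sum>j<n. c j * y ^ j) = 0 \<Longrightarrow> norm y < d"
    using monic_root_small[OF d, of n] by blast
  have "\<forall>\<^sub>F x in at 0. \<forall>j\<in>{..n}. ereal (norm x) < fps_conv_radius (y_coeff A j)"
    by (intro eventually_ball_finite ballI eventually_less_fps_conv_radius y_coeff_conv_radius) auto
  moreover have "\<forall>\<^sub>F x in at 0. \<forall>j\<in>{..<n}. ereal (norm x) < fps_conv_radius (y_coeff r j)"
    by (intro eventually_ball_finite ballI eventually_less_fps_conv_radius y_coeff_conv_radius) auto
  moreover have "\<forall>\<^sub>F x in at 0. \<forall>j\<in>{..<n}. norm (eval_fps (y_coeff A j) x) < \<eta>"
  proof (intro eventually_ball_finite ballI)
    fix j assume "j \<in> {..<n}"
    then have "(eval_fps (y_coeff A j) \<longlongrightarrow> 0) (at 0)"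
      using eval_fps_tendsto_0[OF y_coeff_conv_radius[of A j]] A(3) by (simp add: y_coeff_def)
    then show "\<forall>\<^sub>F x in at 0. norm (eval_fps (y_coeff A j) x) < \<eta>"
      using \<eta>(1) by (auto simp: tendsto_iff)
  qed auto
  moreover have "\<forall>\<^sub>F x in at (0::complex). x \<noteq> 0" by (simp add: eventually_at_filter)
  moreover have "\<forall>\<^sub>F x in at (0::complex). norm x < d"
    using d by (auto simp: eventually_at)
  ultimately have main: "\<forall>\<^sub>F x in at 0. \<forall>j<n. eval_fps (y_coeff r j) x = 0"
  proof eventually_elim
    case (elim x)
    define P where "P = (\<Sum>j<Suc n. monom (eval_fps (y_coeff A j) x) j)"
    define Q where "Q = (\<Sum>j<n. monom (eval_fps (y_coeff r j) x) j)"
    have disc: "(x, y) \<in> polydisc d" if "norm y < d" for y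
      using elim that by (simp add: polydisc_def)
    have top: "eval_fps (y_coeff A n) x = 1"
    proof -
      have "y_coeff A n = 1" by (auto simp: y_coeff_def A(2) fps_eq_iff)
      then show ?thesis by simp
    qed
    have P: "poly P y = conv_eval A (x, y)" if "norm y < d" for y
      unfolding P_def poly_sum_monom using elim
      by (subst conv_eval_expand[OF on(1) disc[OF that], of "Suc n"]) (auto simp: A(1))
    have Q: "poly Q y = conv_eval r (x, y)" if "norm y < d" for y
      unfolding Q_def poly_sum_monom using elim
      by (subst conv_eval_expand[OF on(3) disc[OF that], of n]) (auto simp: r)
    have cP: "coeff P n = 1" unfolding P_def coeff_sum_monom by (simp add: top)
    have cont: "continuous_on (ball 0 d) (\<lambda>y. conv_eval c (x, y))" if "conv_on d c" for c
      by (rule continuous_on_compose2[OF conv_eval_continuous[OF that]])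
        (auto intro!: continuous_intros disc)
    have "P dvd Q"
    proof (rule complex_poly_dvd_if_local[of "ball 0 d"])
      show "conv_eval b (x, y) * poly Q y = poly P y * conv_eval t (x, y)" if "y \<in> ball 0 d" for y
      proof -
        have y: "norm y < d" using that by simp
        have "conv_eval b (x, y) * poly Q y = conv_eval (b * r) (x, y)"
          by (simp add: Q[OF y] conv_eval_mult[OF on(2,3) disc[OF y]])
        also have "\<dots> = poly P y * conv_eval t (x, y)"
          by (simp add: eq P[OF y] conv_eval_mult[OF on(1,4) disc[OF y]])
        finally show ?thesis .
      qed
      show "y \<in> ball 0 d \<and> conv_eval b (x, y) \<noteq> 0" if "poly P y = 0" for y
      proof -
        have "y ^ n + (\<Sum>j<n. eval_fps (y_coeff A j) x * y ^ j) = 0"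
          using that unfolding P_def poly_sum_monom by (simp add: top add.commute)
        then have y: "norm y < d" using elim by (intro \<eta>(2)) auto
        moreover have "conv_eval A (x, y) = 0" using P[OF y] that by simp
        ultimately show ?thesis using isod[OF disc[OF y]] elim by (auto simp: zero_prod_def)
      qed
      show "P \<noteq> 0" using cP by auto
    qed (use cont on in auto)
    moreover have "Q = 0" if "P dvd Q"
    proof (rule ccontr)
      assume "Q \<noteq> 0"
      have "n \<le> degree P" using cP by (intro le_degree) simp
      also have "\<dots> \<le> degree Q" using that \<open>Q \<noteq> 0\<close> by (rule dvd_imp_degree_le)
      finally have "coeff Q (degree Q) = 0" unfolding Q_def coeff_sum_monom by simp
      then show False using \<open>Q \<noteq> 0\<close> by simp
    qed
    ultimately have "Q = 0" by blast
    then have "coeff Q j = 0" for j by simp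
    then show ?case unfolding Q_def coeff_sum_monom by (metis (full_types))
  qed
  \<comment> \<open>A coefficient series that vanishes at all small nonzero x is zero
    identically.\<close>
  have "y_coeff r j = 0" if "j < n" for j
  proof (rule ccontr)
    assume "y_coeff r j \<noteq> 0"
    then have "\<forall>\<^sub>F x in at 0. eval_fps (y_coeff r j) x \<noteq> 0"
      by (rule eval_fps_eventually_nonzero[OF _ y_coeff_conv_radius])
    with main have "\<forall>\<^sub>F x in at (0::complex). False"
      by eventually_elim (use that in auto)
    then show False by (simp add: trivial_limit_def[symmetric])
  qed
  then have "conv_coeff r i j = 0" for i j
    using r[of j i] by (cases "j < n") (auto simp: y_coeff_def fps_eq_iff)
  then show ?thesis by (intro conv_series_eqI) simp
qed

text \<open>Weierstrass division of 1 by \<open>u\<close> with \<open>n = 0\<close> leaves no room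
  for a remainder.\<close>

lemma conv_unit:
  assumes "conv_coeff u 0 0 \<noteq> 0"
  shows "is_unit u"
proof -
  have "y_regular 0 u" using assms by (simp add: y_regular_def)
  then obtain q r where "1 = u * q + r" "\<And>i j. j \<ge> 0 \<Longrightarrow> conv_coeff r i j = 0"
    by (rule weierstrass_division[of 0 u 1]) (rule that)
  moreover from this(2) have "r = 0" by (intro conv_series_eqI) simp
  ultimately show ?thesis by (metis add.right_neutral dvdI)
qed

section \<open>Monomials and Weierstrass preparation\<close>

lemma conv_monomial_exists:
  obtains m where "\<And>i j. conv_coeff m i j = (if i = k \<and> j = l then 1 else 0)"
  by (rule conv_series_exists[of 1 1 "\<lambda>i j. if i = k \<and> j = l then 1 else 0"]) (auto intro: that)

definition conv_monomial :: "nat \<Rightarrow> nat \<Rightarrow> conv_series" where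
  "conv_monomial k l = (SOME m. \<forall>i j. conv_coeff m i j = (if i = k \<and> j = l then 1 else 0))"

lemma conv_coeff_monomial [simp]:
  "conv_coeff (conv_monomial k l) i j = (if i = k \<and> j = l then 1 else 0)"
proof -
  have "\<exists>m. \<forall>i j. conv_coeff m i j = (if i = k \<and> j = l then 1 else 0)"
    using conv_monomial_exists by blast
  then have "\<forall>i j. conv_coeff (conv_monomial k l) i j = (if i = k \<and> j = l then 1 else 0)"
    unfolding conv_monomial_def by (rule someI_ex)
  then show ?thesis by simp
qed

lemma conv_coeff_monomial_mult:
  "conv_coeff (conv_monomial k l * a) i j = (if i \<ge> k \<and> j \<ge> l then conv_coeff a (i - k) (j - l) else 0)"
proof -
  have "conv_coeff (conv_monomial k l * a) i j
      = (\<Sum>(k', l')\<in>{..i} \<times> {..j}. if (k', l') = (k, l) then conv_coeff a (i - k') (j - l') else 0)"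
    unfolding conv_coeff_mult sum.cartesian_product
    by (intro sum.cong refl) (simp split: prod.split)
  also have "\<dots> = (\<Sum>p\<in>{..i} \<times> {..j}. if p = (k, l) then conv_coeff a (i - k) (j - l) else 0)"
    by (intro sum.cong refl) (simp split: prod.split)
  also have "\<dots> = (if i \<ge> k \<and> j \<ge> l then conv_coeff a (i - k) (j - l) else 0)"
    by (subst sum.delta) auto
  finally show ?thesis .
qed

text \<open>The unit is the quotient in the division of the monomial \<open>y ^ n\<close> by
  \<open>a\<close>. Comparing coefficients at \<open>y ^ n\<close> on x = 0 shows that its constant
  term is nonzero.\<close>

lemma weierstrass_preparation:
  assumes "y_regular n a"
  obtains u where "is_unit u" "\<And>i j. j > n \<Longrightarrow> conv_coeff (a * u) i j = 0"
    "\<And>i. conv_coeff (a * u) i n = (if i = 0 then 1 else 0)"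
    "\<And>j. j < n \<Longrightarrow> conv_coeff (a * u) 0 j = 0"
proof -
  obtain q r where q: "conv_monomial 0 n = a * q + r" and r: "\<And>i j. j \<ge> n \<Longrightarrow> conv_coeff r i j = 0"
    by (rule weierstrass_division[OF assms, of "conv_monomial 0 n"]) (rule that)
  have aq: "conv_coeff (a * q) i j = (if i = 0 \<and> j = n then 1 else 0) - conv_coeff r i j" for i j
    using arg_cong[OF q, of "\<lambda>s. conv_coeff s i j"] by (simp add: eq_diff_eq)
  have low: "conv_coeff (a * q) 0 j = 0" if "j < n" for j
    unfolding conv_coeff_mult using that assms by (simp add: y_regular_def)
  have "conv_coeff (a * q) 0 n = conv_coeff a 0 n * conv_coeff q 0 0"
  proof -
    have "{..n} = insert n {..<n}" by auto
    then show ?thesis unfolding conv_coeff_mult using assms by (simp add: y_regular_def)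
  qed
  then have "conv_coeff q 0 0 \<noteq> 0" using aq[of 0 n] r[of n 0] by auto
  then have "is_unit q" by (rule conv_unit)
  then show ?thesis by (rule that) (use low in \<open>auto simp: aq r\<close>)
qed

text \<open>Multiplication by \<open>b\<close> is injective modulo \<open>a\<close>. The quotient
  may be zero, so units are allowed in either place.\<close>

definition regular_pair :: "'a :: comm_semiring_1 \<Rightarrow> 'a \<Rightarrow> bool" where
  "regular_pair a b \<longleftrightarrow> (\<forall>p. a dvd b * p \<longrightarrow> a dvd p)"

lemma regular_pairD: "regular_pair a b \<Longrightarrow> a dvd b * p \<Longrightarrow> a dvd p"
  unfolding regular_pair_def by blast

lemma regular_pair_commute:
  fixes a b :: "'a :: idom"
  assumes "regular_pair a b" "a \<noteq> 0"
  shows "regular_pair b a"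
  unfolding regular_pair_def
proof (intro allI impI)
  fix p assume "b dvd a * p"
  then obtain c where c: "a * p = b * c" by (elim dvdE)
  then have "a dvd b * c" by (metis dvd_triv_left)
  then have "a dvd c" by (rule regular_pairD[OF assms(1)])
  then obtain e where e: "c = a * e" by (elim dvdE)
  then have "a * p = a * (b * e)" using c by (simp add: mult_ac)
  then show "b dvd p" using assms(2) by simp
qed

lemma y_regular_nonzero: "y_regular n a \<Longrightarrow> a \<noteq> 0"
  by (auto simp: y_regular_def)

text \<open>Divide \<open>p\<close> by \<open>a\<close>. The remainder is annihilated by
  \<open>b\<close> modulo the Weierstrass polynomial \<open>a * u\<close> and has smaller degree in
  y, so it is zero.\<close>

theorem regular_pair_of_y_regular:
  assumes "y_regular n a" "isolated_common_zero a b"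
  shows "regular_pair a b"
  unfolding regular_pair_def
proof (intro allI impI)
  fix p assume "a dvd b * p"
  then obtain t where t: "b * p = a * t" by (elim dvdE)
  obtain u where u: "is_unit u" "\<And>i j. j > n \<Longrightarrow> conv_coeff (a * u) i j = 0"
    "\<And>i. conv_coeff (a * u) i n = (if i = 0 then 1 else 0)"
    "\<And>j. j < n \<Longrightarrow> conv_coeff (a * u) 0 j = 0"
    by (rule weierstrass_preparation[OF assms(1)]) (rule that)
  obtain v where v: "u * v = 1" using u(1) by (metis dvdE)
  obtain q r where p: "p = a * q + r" and r: "\<And>i j. j \<ge> n \<Longrightarrow> conv_coeff r i j = 0"
    by (rule weierstrass_division[OF assms(1), of p]) (rule that)
  have "v * (a * u) = a * (u * v)" by (simp only: mult_ac)
  then have "a = v * (a * u) + 0 * b" by (simp add: v)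
  moreover have "b = 0 * (a * u) + 1 * b" by simp
  ultimately have iso: "isolated_common_zero (a * u) b"
    using assms(2) isolated_common_zero_combination by metis
  have "b * r = (a * u) * (v * (t - b * q))"
  proof -
    have "b * r = b * p - a * (b * q)" unfolding p by (simp add: algebra_simps)
    also have "\<dots> = a * (t - b * q)" unfolding t by (simp only: right_diff_distrib)
    finally have "b * r = a * (t - b * q)" .
    then have "b * r = (u * v) * (a * (t - b * q))" by (simp add: v)
    then show ?thesis by (simp only: mult_ac)
  qed
  then have "r = 0" using weierstrass_poly_remainder_zero[OF iso u(2-4) r] by blast
  then show "a dvd p" using p by simp
qed

theorem regular_pair_of_isolated:
  assumes "isolated_common_zero a b"
  shows "regular_pair a b"
proof -
  obtain n where "y_regular n a \<or> y_regular n b"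
    using isolated_common_zero_y_regular[OF assms] by blast
  then show ?thesis
    using regular_pair_of_y_regular assms regular_pair_commute y_regular_nonzero
      isolated_common_zero_commute by metis
qed

section \<open>Colength of ideals\<close>

text \<open>Gaussian elimination without division, for more unknowns than equations.
  \<open>R\<close> will be the subring of series in x alone.\<close>

lemma linear_dependence_over_subring:
  fixes v :: "'s \<Rightarrow> nat \<Rightarrow> 'a :: idom"
  assumes R: "0 \<in> R" "1 \<in> R" "\<And>x y. x \<in> R \<Longrightarrow> y \<in> R \<Longrightarrow> x + y \<in> R"
    "\<And>x y. x \<in> R \<Longrightarrow> y \<in> R \<Longrightarrow> x * y \<in> R" "\<And>x. x \<in> R \<Longrightarrow> - x \<in> R"
    and "finite S" "n < card S" "\<And>s i. s \<in> S \<Longrightarrow> i < n \<Longrightarrow> v s i \<in> R"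
  shows "\<exists>c. (\<forall>s\<in>S. c s \<in> R) \<and> (\<exists>s\<in>S. c s \<noteq> 0) \<and> (\<forall>i<n. (\<Sum>s\<in>S. c s * v s i) = 0)"
  using assms(6-8)
proof (induction n arbitrary: S v)
  case 0
  then have "S \<noteq> {}" by auto
  then show ?case using R by (intro exI[of _ "\<lambda>_. 1"]) auto
next
  case (Suc n)
  show ?case
  proof (cases "\<forall>s\<in>S. v s n = 0")
    case True
    obtain c where "\<forall>s\<in>S. c s \<in> R" "\<exists>s\<in>S. c s \<noteq> 0" "\<forall>i<n. (\<Sum>s\<in>S. c s * v s i) = 0"
      using Suc.IH[of S v] Suc.prems by auto
    with True show ?thesis by (intro exI[of _ c]) (auto simp: less_Suc_eq)
  next
    case False
    then obtain t where t: "t \<in> S" "v t n \<noteq> 0" by blast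
    \<comment> \<open>Cross-multiplication with the pivot row \<open>t\<close> clears the coordinate
      \<open>n\<close>.\<close>
    define w where "w = (\<lambda>s i. v t n * v s i - v s n * v t i)"
    have R_diff: "x - y \<in> R" if "x \<in> R" "y \<in> R" for x y
      using R(3)[OF that(1) R(5)[OF that(2)]] by simp
    have "w s i \<in> R" if "s \<in> S - {t}" "i < n" for s i
      unfolding w_def using that t Suc.prems(3) by (intro R_diff R) auto
    moreover have "n < card (S - {t})" using Suc.prems t by simp
    ultimately obtain c where c: "\<And>s. s \<in> S - {t} \<Longrightarrow> c s \<in> R" "\<exists>s\<in>S - {t}. c s \<noteq> 0"
        "\<And>i. i < n \<Longrightarrow> (\<Sum>s\<in>S - {t}. c s * w s i) = 0"
      using Suc.IH[of "S - {t}" w] Suc.prems(1) by auto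
    \<comment> \<open>The relation for \<open>w\<close> is pulled back to \<open>v\<close>; the
      coefficient at \<open>t\<close> is dictated by the coordinate \<open>n\<close>.\<close>
    define c' where "c' = (\<lambda>s. if s = t then - (\<Sum>s\<in>S - {t}. c s * v s n) else c s * v t n)"
    have sum_R: "sum f A \<in> R" if "\<And>a. a \<in> A \<Longrightarrow> f a \<in> R" for f :: "'s \<Rightarrow> 'a" and A
      using that by (induction A rule: infinite_finite_induct) (auto intro: R)
    have "c' s \<in> R" if "s \<in> S" for s
      unfolding c'_def using that t Suc.prems(3) by (auto intro!: R sum_R c(1))
    moreover have "\<exists>s\<in>S. c' s \<noteq> 0" using c(2) t by (auto simp: c'_def)
    moreover have "(\<Sum>s\<in>S. c' s * v s i) = 0" if "i < Suc n" for i
    proof -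
      have "(\<Sum>s\<in>S. c' s * v s i) = c' t * v t i + (\<Sum>s\<in>S - {t}. c' s * v s i)"
        using Suc.prems(1) t(1) by (rule sum.remove)
      also have "(\<Sum>s\<in>S - {t}. c' s * v s i) = (\<Sum>s\<in>S - {t}. c s * (v t n * v s i))"
        by (rule sum.cong) (auto simp: c'_def mult.assoc)
      also have "c' t * v t i = - (\<Sum>s\<in>S - {t}. c s * (v s n * v t i))"
        by (simp add: c'_def sum_distrib_right mult.assoc)
      finally have "(\<Sum>s\<in>S. c' s * v s i) = (\<Sum>s\<in>S - {t}. c s * w s i)"
        by (simp add: w_def right_diff_distrib sum_subtractf)
      moreover have "(\<Sum>s\<in>S - {t}. c s * w s n) = 0" by (simp add: w_def mult.commute)
      ultimately show ?thesis using c(3) that by (auto simp: less_Suc_eq)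
    qed
    ultimately show ?thesis by blast
  qed
qed

section \<open>Finite-dimensional quotients\<close>

definition finite_quot :: "conv_series set \<Rightarrow> bool" where
  "finite_quot I \<longleftrightarrow> (\<exists>B. finite B \<and> conv_vs.span (B \<union> I) = UNIV)"

lemma finite_quot_mono: "finite_quot I \<Longrightarrow> I \<subseteq> J \<Longrightarrow> finite_quot J"
  unfolding finite_quot_def using conv_vs.span_mono[of "_ \<union> I" "_ \<union> J"] by blast

text \<open>Independence of \<open>B\<close> and trivial intersection of its span with
  \<open>I\<close> merge into a single condition, linear independence modulo
  \<open>I\<close>.\<close>

lemma basis_mod_iff:
  assumes "conv_vs.subspace I" "finite B"
  shows "basis_mod I B \<longleftrightarrow> (\<forall>u. (\<Sum>b\<in>B. conv_scale (u b) b) \<in> I \<longrightarrow> (\<forall>b\<in>B. u b = 0)) \<and>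
    conv_vs.span (B \<union> I) = UNIV"
proof -
  have "conv_vs.independent B \<and> conv_vs.span B \<inter> I = {0} \<longleftrightarrow>
      (\<forall>u. (\<Sum>b\<in>B. conv_scale (u b) b) \<in> I \<longrightarrow> (\<forall>b\<in>B. u b = 0))" (is "?L \<longleftrightarrow> ?R")
  proof
    assume L: ?L
    show ?R
    proof (intro allI impI)
      fix u assume "(\<Sum>b\<in>B. conv_scale (u b) b) \<in> I"
      moreover have "(\<Sum>b\<in>B. conv_scale (u b) b) \<in> conv_vs.span B"
        by (intro conv_vs.span_sum conv_vs.span_scale conv_vs.span_base)
      ultimately have "(\<Sum>b\<in>B. conv_scale (u b) b) = 0" using L by blast
      then show "\<forall>b\<in>B. u b = 0" using L assms(2) by (auto simp: conv_vs.dependent_finite)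
    qed
  next
    assume R: ?R
    have "conv_vs.independent B"
      using R conv_vs.subspace_0[OF assms(1)] assms(2) by (auto simp: conv_vs.dependent_finite)
    moreover have "x = 0" if x: "x \<in> conv_vs.span B" "x \<in> I" for x
    proof -
      obtain u where "x = (\<Sum>b\<in>B. conv_scale (u b) b)"
        using x(1) unfolding conv_vs.span_finite[OF assms(2)] by blast
      moreover from this have "\<forall>b\<in>B. u b = 0" using R x(2) by blast
      ultimately show ?thesis by simp
    qed
    ultimately show ?L using conv_vs.subspace_0[OF assms(1)] conv_vs.span_zero by blast
  qed
  then show ?thesis by (auto simp: basis_mod_def)
qed

lemma basis_mod_exists:
  assumes I: "conv_vs.subspace I" and "finite_quot I"
  obtains B where "finite B" "basis_mod I B"
proof -
  define P where "P = (\<lambda>B. finite B \<and> conv_vs.span (B \<union> I) = UNIV)"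
  define B where "B = arg_min card P"
  have "\<exists>B. P B" using assms(2) by (simp add: finite_quot_def P_def)
  then have B: "P B" and min: "\<And>B'. P B' \<Longrightarrow> card B \<le> card B'"
    unfolding B_def by (auto intro: arg_min_natI arg_min_nat_le)
  have fin: "finite B" using B by (simp add: P_def)
  have "u b = 0" if u: "(\<Sum>b\<in>B. conv_scale (u b) b) \<in> I" and b: "b \<in> B" for u b
  proof (rule ccontr)
    assume ub: "u b \<noteq> 0"
    define T where "T = conv_vs.span ((B - {b}) \<union> I)"
    have "(\<Sum>b\<in>B. conv_scale (u b) b) - (\<Sum>b\<in>B - {b}. conv_scale (u b) b) \<in> T"
      unfolding T_def using u
      by (intro conv_vs.span_diff conv_vs.span_sum conv_vs.span_scale conv_vs.span_base) auto
    also have "(\<Sum>b\<in>B. conv_scale (u b) b) - (\<Sum>b\<in>B - {b}. conv_scale (u b) b) = conv_scale (u b) b"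
      using sum.remove[OF fin b, of "\<lambda>b. conv_scale (u b) b"] by simp
    finally have "conv_scale (inverse (u b)) (conv_scale (u b) b) \<in> T"
      unfolding T_def by (rule conv_vs.span_scale)
    then have "b \<in> T" using ub by simp
    then have "conv_vs.span (B \<union> I) \<subseteq> T"
      unfolding T_def by (intro conv_vs.span_minimal) (auto intro: conv_vs.span_base)
    then have "P (B - {b})" using B by (auto simp: P_def T_def)
    then have "card B \<le> card (B - {b})" by (rule min)
    then show False using fin b by (metis card_Diff1_less not_le)
  qed
  then have "basis_mod I B" using B fin by (auto simp: basis_mod_iff[OF I] P_def)
  then show ?thesis using that fin by blast
qed

lemma quot_dim_eq_infinity_iff:
  assumes "conv_vs.subspace I"
  shows "quot_dim I = \<infinity> \<longleftrightarrow> \<not> finite_quot I"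
proof
  assume "quot_dim I = \<infinity>"
  then show "\<not> finite_quot I"
    by (metis assms basis_mod_exists enat.distinct(1) quot_dim_eqI)
next
  assume "\<not> finite_quot I"
  then have "\<not> (\<exists>B. finite B \<and> basis_mod I B)"
    by (auto simp: finite_quot_def basis_mod_def)
  then show "quot_dim I = \<infinity>" by (auto simp: quot_dim_def)
qed

lemma quot_dim_ideal_finite_iff: "quot_dim (conv_ideal S) \<noteq> \<infinity> \<longleftrightarrow> finite_quot (conv_ideal S)"
  by (simp add: quot_dim_eq_infinity_iff conv_subspace_ideal)

lemma conv_ideal_insert: "conv_ideal (insert H S) = {H * h + s |h s. s \<in> conv_ideal S}"
proof -
  have "x - k * H \<in> conv_ideal S \<longleftrightarrow> (\<exists>s. x = H * k + s \<and> s \<in> conv_ideal S)" for x k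
    by (auto simp: mult.commute diff_eq_eq add.commute intro!: exI[of _ "x - k * H"])
  then show ?thesis by (auto simp: conv_mod.span_insert)
qed

lemma conv_ideal_mult_image: "conv_ideal ((*) L ` S) = (*) L ` conv_ideal S"
proof
  have "conv_mod.subspace ((*) L ` conv_ideal S)"
    unfolding conv_mod.subspace_def
  proof (intro conjI ballI allI)
    show "0 \<in> (*) L ` conv_ideal S" using conv_mod.span_zero by (force intro: image_eqI[of _ _ 0])
    show "x + y \<in> (*) L ` conv_ideal S" if "x \<in> (*) L ` conv_ideal S" "y \<in> (*) L ` conv_ideal S" for x y
      using that by (auto simp: conv_mod.span_add simp flip: distrib_left)
    show "c * x \<in> (*) L ` conv_ideal S" if "x \<in> (*) L ` conv_ideal S" for c x
      using that by (auto simp: mult.left_commute conv_mod.span_scale)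
  qed
  then show "conv_ideal ((*) L ` S) \<subseteq> (*) L ` conv_ideal S"
    by (intro conv_mod.span_minimal) (auto intro: conv_mod.span_base)
  have "L * x \<in> conv_ideal ((*) L ` S)" if "x \<in> conv_ideal S" for x
    using that
  proof (induction rule: conv_mod.span_induct_alt)
    case (step c x y)
    then have "c * (L * x) + L * y \<in> conv_ideal ((*) L ` S)"
      by (intro conv_mod.span_add[OF conv_mod.span_scale[OF conv_mod.span_base]]) auto
    then show ?case by (simp add: distrib_left mult.left_commute)
  qed (simp add: conv_mod.span_zero)
  then show "(*) L ` conv_ideal S \<subseteq> conv_ideal ((*) L ` S)" by blast
qed

lemma mult_conv_scale: "L * conv_scale c x = conv_scale c (L * x)"
  by (simp add: conv_scale_def mult.left_commute)

text \<open>For \<open>L\<close> regular modulo \<open>H\<close>, multiplication by \<open>L\<close> identifies \<open>\<O>/(S, H)\<close> with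
  \<open>(L, H)/(L S, H)\<close>.\<close>

theorem quot_dim_regular_mult:
  assumes reg: "regular_pair H L"
  shows "quot_dim (conv_ideal (insert H ((*) L ` S)))
       = quot_dim (conv_ideal {H, L}) + quot_dim (conv_ideal (insert H S))"
    (is "quot_dim ?K = quot_dim ?M + quot_dim ?N")
proof (cases "finite_quot ?M \<and> finite_quot ?N")
  case False
  \<comment> \<open>In this case the first ideal lies in each of the other two, so it inherits
    infinite colength and both sides are infinite.\<close>
  have KM: "L * s \<in> ?M" for s
    using conv_mod.span_scale[OF conv_mod.span_base, of L "{H, L}" s] by (simp add: mult.commute)
  have KN: "L * s \<in> ?N" if "s \<in> S" for s
    using that by (intro conv_mod.span_scale conv_mod.span_base) simp
  have "insert H ((*) L ` S) \<subseteq> ?M" "insert H ((*) L ` S) \<subseteq> ?N"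
    using KM KN by (auto intro: conv_mod.span_base)
  then have "?K \<subseteq> ?M" "?K \<subseteq> ?N"
    using conv_mod.span_minimal conv_mod.subspace_span by blast+
  then have "\<not> finite_quot ?K" using False finite_quot_mono by blast
  then have "quot_dim ?K = \<infinity>" "quot_dim ?M = \<infinity> \<or> quot_dim ?N = \<infinity>"
    using False by (simp_all add: quot_dim_eq_infinity_iff[OF conv_subspace_ideal])
  then show ?thesis by auto
next
  case True
  obtain B1 B2 where B1: "finite B1" "basis_mod ?M B1" and B2: "finite B2" "basis_mod ?N B2"
    using True basis_mod_exists conv_subspace_ideal by metis
  note B1' = B1(2)[unfolded basis_mod_iff[OF conv_subspace_ideal B1(1)]]
  note B2' = B2(2)[unfolded basis_mod_iff[OF conv_subspace_ideal B2(1)]]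
  have K: "x \<in> ?K \<longleftrightarrow> (\<exists>h s. x = H * h + L * s \<and> s \<in> conv_ideal S)" for x
    by (auto simp: conv_ideal_insert conv_ideal_mult_image)
  have M: "x \<in> ?M \<longleftrightarrow> (\<exists>h s. x = H * h + L * s)" for x
    by (auto simp: conv_ideal_insert[of H] conv_mod.span_singleton mult.commute)
  have N: "x \<in> ?N \<longleftrightarrow> (\<exists>h s. x = H * h + s \<and> s \<in> conv_ideal S)" for x
    by (auto simp: conv_ideal_insert)
  have KM: "x \<in> ?M" if "x \<in> ?K" for x using that unfolding K M by blast
  have LM: "L * x \<in> ?M" for x unfolding M by (intro exI[of _ 0] exI[of _ x]) simp
  \<comment> \<open>Here regularity enters: it gives the exactness of the sequence of quotients
    defined by multiplication by \<open>L\<close>.\<close>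
  have LN: "L * x \<in> ?K \<longleftrightarrow> x \<in> ?N" for x
  proof
    assume "x \<in> ?N"
    then obtain h s where "x = H * h + s" "s \<in> conv_ideal S" unfolding N by blast
    then show "L * x \<in> ?K"
      unfolding K by (intro exI[of _ "L * h"] exI[of _ s]) (simp add: algebra_simps)
  next
    assume "L * x \<in> ?K"
    then obtain h s where hs: "L * x = H * h + L * s" "s \<in> conv_ideal S" unfolding K by blast
    then have "L * (x - s) = H * h" by (simp add: algebra_simps)
    then have "H dvd x - s" using regular_pairD[OF reg] by (metis dvd_triv_left)
    then obtain k where "x - s = H * k" by (elim dvdE)
    then have "x = H * k + s" by (simp add: diff_eq_eq)
    then show "x \<in> ?N" unfolding N using hs by blast
  qed
  have inj: "inj_on ((*) L) B2"
  proof (rule inj_onI, rule ccontr)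
    fix b b' assume b: "b \<in> B2" "b' \<in> B2" "L * b = L * b'" "b \<noteq> b'"
    define u where "u = (\<lambda>x. if x = b then 1 else if x = b' then - 1 else (0::complex))"
    have "L * (b - b') = 0" using b by (simp add: right_diff_distrib)
    then have "L * (b - b') \<in> ?K" using conv_mod.span_zero by (simp only:)
    then have "b - b' \<in> ?N" unfolding LN .
    also have "b - b' = (\<Sum>x\<in>B2. conv_scale (u x) x)"
    proof -
      have "(\<Sum>x\<in>B2. conv_scale (u x) x) = (\<Sum>x\<in>{b, b'}. conv_scale (u x) x)"
        using b B2(1) by (intro sum.mono_neutral_right) (auto simp: u_def)
      then show ?thesis using b by (simp add: u_def)
    qed
    finally have "u b = 0" using B2' b by blast
    then show False by (simp add: u_def)
  qed
  have disj: "B1 \<inter> (*) L ` B2 = {}"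
  proof (rule ccontr)
    assume "B1 \<inter> (*) L ` B2 \<noteq> {}"
    then obtain x where x: "L * x \<in> B1" by blast
    define u where "u = (\<lambda>y. if y = L * x then 1 else (0::complex))"
    have "(\<Sum>y\<in>B1. conv_scale (u y) y) = (\<Sum>y\<in>B1. if y = L * x then y else 0)"
      by (rule sum.cong) (auto simp: u_def)
    also have "\<dots> = L * x" using x B1(1) by simp
    finally have "(\<Sum>y\<in>B1. conv_scale (u y) y) \<in> ?M" using LM by simp
    then have "u (L * x) = 0" using B1' x by blast
    then show False by (simp add: u_def)
  qed
  \<comment> \<open>A basis of the cokernel together with the image of a basis of the kernel
    term.\<close>
  define B where "B = B1 \<union> (*) L ` B2"
  have finB: "finite B" using B1 B2 by (simp add: B_def)
  have "basis_mod ?K B"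
    unfolding basis_mod_iff[OF conv_subspace_ideal finB]
  proof (intro conjI allI impI)
    fix u assume u: "(\<Sum>b\<in>B. conv_scale (u b) b) \<in> ?K"
    define x where "x = (\<Sum>b\<in>B2. conv_scale (u (L * b)) b)"
    have eq: "(\<Sum>b\<in>B. conv_scale (u b) b) = (\<Sum>b\<in>B1. conv_scale (u b) b) + L * x"
      unfolding B_def x_def using B1(1) B2(1) disj inj
      by (simp add: sum.union_disjoint sum.reindex sum_distrib_left mult_conv_scale)
    have "(\<Sum>b\<in>B. conv_scale (u b) b) - L * x \<in> ?M"
      using KM[OF u] LM by (rule conv_mod.span_diff)
    then have "(\<Sum>b\<in>B1. conv_scale (u b) b) \<in> ?M" by (simp add: eq)
    then have u1: "\<forall>b\<in>B1. u b = 0" using B1' by blast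
    then have "L * x \<in> ?K" using u eq by simp
    then have "\<forall>b\<in>B2. u (L * b) = 0"
      using B2'[THEN conjunct1, THEN spec, of "\<lambda>b. u (L * b)"] unfolding LN x_def by blast
    then show "\<forall>b\<in>B. u b = 0" using u1 by (auto simp: B_def)
  next
    \<comment> \<open>Reduce \<open>g\<close> modulo \<open>(H, L)\<close> first, then reduce the
      cofactor of \<open>L\<close> modulo \<open>(H, S)\<close>.\<close>
    have "g \<in> conv_vs.span (B \<union> ?K)" for g
    proof -
      have split: "\<exists>s t. g = s + t \<and> s \<in> conv_vs.span A \<and> t \<in> I"
        if "conv_vs.span (A \<union> I) = UNIV" "conv_vs.subspace I" for A I g
      proof -
        have "g \<in> conv_vs.span (A \<union> I)" using that by simp
        then show ?thesis
          unfolding conv_vs.span_Un using that(2) conv_vs.span_eq_iff by blast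
      qed
      obtain s1 t1 where 1: "g = s1 + t1" "s1 \<in> conv_vs.span B1" "t1 \<in> ?M"
        using split[of B1 ?M g] B1' conv_subspace_ideal by blast
      obtain h x where t1: "t1 = H * h + L * x" using 1(3) unfolding M by blast
      obtain s2 t2 where 2: "x = s2 + t2" "s2 \<in> conv_vs.span B2" "t2 \<in> ?N"
        using split[of B2 ?N x] B2' conv_subspace_ideal by blast
      have "s1 \<in> conv_vs.span (B \<union> ?K)"
        using 1(2) conv_vs.span_mono[of B1 "B \<union> ?K"] by (auto simp: B_def)
      moreover have "L * s2 \<in> conv_vs.span (B \<union> ?K)"
      proof -
        obtain u where "s2 = (\<Sum>b\<in>B2. conv_scale (u b) b)"
          using 2(2) unfolding conv_vs.span_finite[OF B2(1)] by blast
        then have "L * s2 = (\<Sum>b\<in>B2. conv_scale (u b) (L * b))"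
          by (simp add: sum_distrib_left mult_conv_scale)
        also have "\<dots> \<in> conv_vs.span (B \<union> ?K)"
          by (intro conv_vs.span_sum conv_vs.span_scale conv_vs.span_base) (auto simp: B_def)
        finally show ?thesis .
      qed
      moreover have "L * t2 \<in> conv_vs.span (B \<union> ?K)"
        using 2(3) LN by (intro conv_vs.span_base) auto
      moreover have "H * h \<in> conv_vs.span (B \<union> ?K)"
      proof (intro conv_vs.span_base UnI2)
        show "H * h \<in> ?K" unfolding K using conv_mod.span_zero[of S]
          by (intro exI[of _ h] exI[of _ 0]) simp
      qed
      ultimately have "s1 + (H * h + (L * s2 + L * t2)) \<in> conv_vs.span (B \<union> ?K)"
        by (intro conv_vs.span_add)
      then show ?thesis using 1(1) 2(1) t1 by (simp add: distrib_left)
    qed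
    then show "conv_vs.span (B \<union> ?K) = UNIV" by blast
  qed
  then have "quot_dim ?K = enat (card B)"
    by (rule quot_dim_eqI[OF conv_subspace_ideal finB])
  also have "card B = card B1 + card B2"
    unfolding B_def using B1(1) B2(1) disj inj by (simp add: card_Un_disjoint card_image)
  finally show ?thesis
    by (simp add: quot_dim_eqI[OF conv_subspace_ideal B1] quot_dim_eqI[OF conv_subspace_ideal B2])
qed

section \<open>Finiteness of the colength\<close>

lemma regular_pair_power: "regular_pair a b \<Longrightarrow> a dvd b ^ m * p \<Longrightarrow> a dvd p"
  by (induction m) (auto simp: mult.assoc dest: regular_pairD)

text \<open>Division by \<open>a\<close> brings the degree in y below \<open>n\<close>, and
  \<open>x ^ k\<close> brings the degree in x below \<open>k\<close>; the finitely many remaining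
  monomials span.\<close>

lemma finite_quot_y_regular:
  assumes "y_regular n a" and X: "conv_monomial k 0 \<in> I" "a \<in> I" and I: "conv_mod.subspace I"
  shows "finite_quot I"
proof -
  define B where "B = (\<lambda>(i, j). conv_monomial i j) ` ({..<k} \<times> {..<n})"
  have "g \<in> conv_vs.span (B \<union> I)" for g
  proof -
    obtain q r where g: "g = a * q + r" and r: "\<And>i j. j \<ge> n \<Longrightarrow> conv_coeff r i j = 0"
      by (rule weierstrass_division[OF assms(1), of g]) (rule that)
    obtain s where s: "\<And>i j. conv_coeff s i j = conv_coeff r (i + k) j"
      by (rule conv_coeff_shift[of r k]) (rule that)
    define t where "t = (\<Sum>i<k. \<Sum>j<n. conv_scale (conv_coeff r i j) (conv_monomial i j))"
    have "conv_coeff t i j = (if i < k \<and> j < n then conv_coeff r i j else 0)" for i j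
    proof -
      have "conv_coeff t i j = (\<Sum>i'<k. \<Sum>j'<n. if i' = i then (if j' = j then conv_coeff r i j else 0) else 0)"
        unfolding t_def conv_coeff_sum by (intro sum.cong refl) simp
      also have "\<dots> = (\<Sum>i'<k. if i' = i then (\<Sum>j'<n. if j' = j then conv_coeff r i j else 0) else 0)"
        by (intro sum.cong refl) simp
      also have "\<dots> = (if i < k \<and> j < n then conv_coeff r i j else 0)" by simp
      finally show ?thesis .
    qed
    then have "r = t + conv_monomial k 0 * s"
      by (intro conv_series_eqI) (auto simp: conv_coeff_monomial_mult s r not_less)
    then have "g = t + (q * a + s * conv_monomial k 0)" using g by (simp add: mult_ac)
    moreover have "t \<in> conv_vs.span (B \<union> I)"
      unfolding t_def
      by (intro conv_vs.span_sum conv_vs.span_scale conv_vs.span_base) (auto simp: B_def)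
    moreover have "q * a + s * conv_monomial k 0 \<in> I"
      using X by (intro conv_mod.subspace_add[OF I] conv_mod.subspace_scale[OF I])
    ultimately show ?thesis by (metis UnI2 conv_vs.span_add conv_vs.span_base)
  qed
  moreover have "finite B" by (simp add: B_def)
  ultimately show ?thesis unfolding finite_quot_def by blast
qed

lemma x_series_unit_times_monomial:
  assumes "\<And>i j. j > 0 \<Longrightarrow> conv_coeff c i j = 0" "c \<noteq> 0"
  obtains k u where "is_unit u" "c = conv_monomial k 0 * u"
proof -
  have "\<exists>i. conv_coeff c i 0 \<noteq> 0"
    using assms conv_series_eqI[of c 0] by (metis conv_coeff_simps(4) neq0_conv)
  then obtain k where k: "conv_coeff c k 0 \<noteq> 0" "\<And>i. i < k \<Longrightarrow> conv_coeff c i 0 = 0"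
    using exists_least_iff[of "\<lambda>i. conv_coeff c i 0 \<noteq> 0"] by blast
  obtain u where u: "\<And>i j. conv_coeff u i j = conv_coeff c (i + k) j"
    by (rule conv_coeff_shift[of c k]) (rule that)
  have "conv_coeff c i j = 0" if "i < k" for i j
    using k(2)[OF that] assms(1)[of j i] by (cases "j = 0") auto
  then have "c = conv_monomial k 0 * u"
    by (intro conv_series_eqI) (simp add: conv_coeff_monomial_mult u)
  moreover have "is_unit u" using k(1) by (intro conv_unit) (simp add: u)
  ultimately show ?thesis using that by blast
qed

text \<open>The powers \<open>1, b, \<dots>, b\<^sup>n\<close> are linearly dependent in the free \<open>\<complex>{x}\<close>-module
  \<open>\<O>/(a)\<close> of rank \<open>n\<close>; cancelling a power of \<open>b\<close> puts some \<open>c(x) \<noteq> 0\<close> into \<open>(a, b)\<close>.\<close>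

lemma finite_quot_regular_pair:
  assumes a: "y_regular n a" and reg: "regular_pair a b"
  shows "finite_quot (conv_ideal {a, b})"
proof -
  define R where "R = {c. \<forall>i j. j > 0 \<longrightarrow> conv_coeff c i j = 0}"
  have "\<exists>q r. b ^ i = a * q + r \<and> (\<forall>k j. j \<ge> n \<longrightarrow> conv_coeff r k j = 0)" for i
    by (rule weierstrass_division[OF a, of "b ^ i"]) blast
  then obtain q r where qr: "\<And>i. b ^ i = a * q i + r i"
      and r: "\<And>i k j. j \<ge> n \<Longrightarrow> conv_coeff (r i) k j = 0" by metis
  have "\<exists>v. \<forall>k l. conv_coeff v k l = (if l = 0 then conv_coeff (r i) k j else 0)" for i j
  proof -
    obtain C N where *: "C > 0" "N \<ge> 1" "\<And>k l. norm (conv_coeff (r i) k l) \<le> C * N ^ (k + l)"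
      by (rule conv_coeff_bound[of "r i"]) (rule that)
    have "norm (if l = 0 then conv_coeff (r i) k j else 0) \<le> C * N ^ j * N ^ (k + l)" for k l
      using *(3)[of k j] * by (auto simp: power_add mult_ac)
    moreover have "0 \<le> C * N ^ j" using * by simp
    ultimately show ?thesis
      using conv_series_exists[of "C * N ^ j" N "\<lambda>k l. if l = 0 then conv_coeff (r i) k j else 0"] *(2)
      by metis
  qed
  \<comment> \<open>The \<open>v i j\<close> are the coordinates of \<open>b ^ i\<close> over the
    series in x, with respect to the basis of powers of y below \<open>n\<close>.\<close>
  then obtain v where v: "\<And>i j k l. conv_coeff (v i j) k l = (if l = 0 then conv_coeff (r i) k j else 0)"
    by metis
  have rv: "r i = (\<Sum>j<n. v i j * conv_monomial 0 j)" for i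
  proof (rule conv_series_eqI)
    fix k l
    have "conv_coeff (\<Sum>j<n. v i j * conv_monomial 0 j) k l = (\<Sum>j<n. if j = l then conv_coeff (r i) k l else 0)"
      unfolding conv_coeff_sum
      by (intro sum.cong refl) (auto simp: mult.commute[of _ "conv_monomial _ _"] conv_coeff_monomial_mult v)
    then show "conv_coeff (r i) k l = conv_coeff (\<Sum>j<n. v i j * conv_monomial 0 j) k l"
      using r[of l i k] by auto
  qed
  have R_mult: "x * y \<in> R" if "x \<in> R" "y \<in> R" for x y
  proof -
    have "conv_coeff x k l * conv_coeff y (i - k) (j - l) = 0" if "j > 0" "l \<le> j" for i j k l
      using that \<open>x \<in> R\<close> \<open>y \<in> R\<close> by (cases "l = 0") (auto simp: R_def)
    then have "conv_coeff (x * y) i j = 0" if "j > 0" for i j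
      unfolding conv_coeff_mult using that by (intro sum.neutral ballI) (simp only: atMost_iff)
    then show ?thesis unfolding R_def by blast
  qed
  have "\<exists>c. (\<forall>i\<in>{..n}. c i \<in> R) \<and> (\<exists>i\<in>{..n}. c i \<noteq> 0) \<and> (\<forall>j<n. (\<Sum>i\<in>{..n}. c i * v i j) = 0)"
  proof (rule linear_dependence_over_subring)
    show "x * y \<in> R" if "x \<in> R" "y \<in> R" for x y using that by (rule R_mult)
  qed (auto simp: R_def v)
  then obtain c where cR: "\<And>i. i \<le> n \<Longrightarrow> c i \<in> R" and cn: "\<exists>i. i \<le> n \<and> c i \<noteq> 0"
      and cv: "\<And>j. j < n \<Longrightarrow> (\<Sum>i\<le>n. c i * v i j) = 0" by auto
  \<comment> \<open>The lowest power of \<open>b\<close> occurring in the relation, which regularity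
    allows to cancel.\<close>
  define m where "m = (LEAST i. i \<le> n \<and> c i \<noteq> 0)"
  have m: "m \<le> n" "c m \<noteq> 0" using LeastI_ex[OF cn] by (simp_all add: m_def)
  have less: "c i = 0" if "i < m" for i
    using not_less_Least[OF that[unfolded m_def]] that m(1) by auto
  define s where "s = (\<Sum>i\<in>{m<..n}. c i * b ^ (i - m - 1))"
  have "(\<Sum>i\<le>n. c i * b ^ i) = a * (\<Sum>i\<le>n. c i * q i)"
  proof -
    have "(\<Sum>i\<le>n. c i * r i) = (\<Sum>i\<le>n. \<Sum>j<n. c i * v i j * conv_monomial 0 j)"
      by (simp add: rv sum_distrib_left mult.assoc)
    also have "\<dots> = (\<Sum>j<n. (\<Sum>i\<le>n. c i * v i j) * conv_monomial 0 j)"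
      by (subst sum.swap) (simp add: sum_distrib_right)
    also have "\<dots> = 0" by (simp add: cv)
    finally have "(\<Sum>i\<le>n. c i * r i) = 0" .
    then show ?thesis
      by (simp add: qr distrib_left sum.distrib sum_distrib_left mult.left_commute)
  qed
  moreover have "(\<Sum>i\<le>n. c i * b ^ i) = b ^ m * (c m + b * s)"
  proof -
    have "(\<Sum>i\<le>n. c i * b ^ i) = (\<Sum>i\<in>insert m {m<..n}. c i * b ^ i)"
      using m(1) by (intro sum.mono_neutral_right) (auto simp: less)
    also have "\<dots> = c m * b ^ m + (\<Sum>i\<in>{m<..n}. c i * b ^ i)" by simp
    also have "(\<Sum>i\<in>{m<..n}. c i * b ^ i) = (\<Sum>i\<in>{m<..n}. b ^ m * (b * (c i * b ^ (i - m - 1))))"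
    proof (rule sum.cong[OF refl])
      fix i assume "i \<in> {m<..n}"
      then have "b ^ i = b ^ m * (b * b ^ (i - m - 1))"
        by (simp flip: power_add power_Suc)
      then show "c i * b ^ i = b ^ m * (b * (c i * b ^ (i - m - 1)))" by (simp only: mult_ac)
    qed
    finally show ?thesis by (simp add: s_def sum_distrib_left distrib_left mult.commute)
  qed
  ultimately have "a dvd b ^ m * (c m + b * s)" by (metis dvd_triv_left)
  then have "a dvd c m + b * s" by (rule regular_pair_power[OF reg])
  then obtain e where e: "c m + b * s = a * e" by (elim dvdE)
  have "e * a - s * b \<in> conv_ideal {a, b}"
    by (intro conv_mod.span_diff conv_mod.span_scale conv_mod.span_base) auto
  also have "e * a - s * b = c m" using e by (simp add: algebra_simps)
  finally have cm: "c m \<in> conv_ideal {a, b}" .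
  \<comment> \<open>A nonzero series in x is a power of x times a unit, so that power of x lies in
    the ideal.\<close>
  obtain k u where u: "is_unit u" "c m = conv_monomial k 0 * u"
  proof (rule x_series_unit_times_monomial[of "c m"])
    show "conv_coeff (c m) i j = 0" if "j > 0" for i j
      using cR[OF m(1)] that by (simp add: R_def)
  qed (use m(2) that in auto)
  obtain w where w: "u * w = 1" using u(1) by (metis dvdE)
  have "w * c m \<in> conv_ideal {a, b}" using cm by (rule conv_mod.span_scale)
  also have "w * c m = (u * w) * conv_monomial k 0" using u(2) by (simp only: mult_ac)
  finally have "conv_monomial k 0 \<in> conv_ideal {a, b}" by (simp add: w)
  then show ?thesis
    by (rule finite_quot_y_regular[OF a]) (auto intro: conv_mod.span_base conv_mod.subspace_span)
qed

theorem finite_quot_isolated: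
  assumes "isolated_common_zero a b"
  shows "finite_quot (conv_ideal {a, b})"
proof -
  obtain n where "y_regular n a \<or> y_regular n b"
    using isolated_common_zero_y_regular[OF assms] by blast
  then show ?thesis
    using finite_quot_regular_pair regular_pair_of_isolated assms
      isolated_common_zero_commute insert_commute by metis
qed

section \<open>Pencils and derivations\<close>

lemma regular_pair_mult_right:
  "regular_pair a b \<Longrightarrow> regular_pair a c \<Longrightarrow> regular_pair a (b * c)"
  unfolding regular_pair_def by (metis mult.assoc)

lemma regular_pair_mult_left:
  fixes a b c :: "'a :: idom"
  assumes "regular_pair a c" "regular_pair b c"
  shows "regular_pair (a * b) c"
  unfolding regular_pair_def
proof (intro allI impI)
  fix p assume p: "a * b dvd c * p"
  then have "a dvd c * p" by (rule dvd_mult_left)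
  then have "a dvd p" by (rule regular_pairD[OF assms(1)])
  then obtain q where q: "p = a * q" by (elim dvdE)
  show "a * b dvd p"
  proof (cases "a = 0")
    case False
    have "a * b dvd a * (c * q)" using p by (simp add: q mult.left_commute)
    then have "b dvd c * q" using False by simp
    then have "b dvd q" by (rule regular_pairD[OF assms(2)])
    then show ?thesis by (simp add: q)
  qed (simp add: q)
qed

lemma regular_pair_add_multiple:
  fixes a b c :: "'a :: comm_ring_1"
  assumes "regular_pair a b"
  shows "regular_pair a (b + a * c)"
proof -
  have "(b + a * c) * p = b * p + a * (c * p)" for p by (simp add: algebra_simps)
  moreover have "a dvd b * p + a * (c * p) \<longleftrightarrow> a dvd b * p" for p by (rule dvd_add_left_iff) simp
  ultimately show ?thesis using assms unfolding regular_pair_def by metis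
qed

lemma regular_pair_unit_right: "is_unit u \<Longrightarrow> regular_pair a u"
  unfolding regular_pair_def by (simp add: dvd_mult_unit_iff')

lemma regular_pair_unit_left: "is_unit u \<Longrightarrow> regular_pair u b"
  unfolding regular_pair_def by (simp add: unit_imp_dvd)

section \<open>Changing generators of an ideal\<close>

lemma conv_ideal_eqI:
  assumes "\<And>x. x \<in> S \<Longrightarrow> x \<in> conv_ideal T" "\<And>x. x \<in> T \<Longrightarrow> x \<in> conv_ideal S"
  shows "conv_ideal S = conv_ideal T"
  using assms by (simp add: conv_mod.span_eq subset_iff)

lemma conv_ideal_insert_unit:
  assumes "is_unit u"
  shows "conv_ideal (insert (u * a) S) = conv_ideal (insert a S)"
proof (rule conv_ideal_eqI)
  fix x assume "x \<in> insert (u * a) S"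
  then show "x \<in> conv_ideal (insert a S)"
    by (auto intro: conv_mod.span_base conv_mod.span_scale)
next
  fix x assume x: "x \<in> insert a S"
  obtain v where v: "u * v = 1" using assms by (metis dvdE)
  have "v * (u * a) \<in> conv_ideal (insert (u * a) S)"
    by (intro conv_mod.span_scale conv_mod.span_base) simp
  also have "v * (u * a) = u * v * a" by (simp only: mult_ac)
  finally show "x \<in> conv_ideal (insert (u * a) S)"
    using x by (auto simp: v intro: conv_mod.span_base)
qed

lemma conv_ideal_insert_add:
  assumes "c \<in> conv_ideal S"
  shows "conv_ideal (insert (a + c) S) = conv_ideal (insert a S)"
proof -
  have c: "c \<in> conv_ideal (insert x S)" for x
    using assms conv_mod.span_mono[of S "insert x S"] by auto
  have "a + c \<in> conv_ideal (insert a S)"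
    using c by (intro conv_mod.span_add) (auto intro: conv_mod.span_base)
  moreover have "(a + c) - c \<in> conv_ideal (insert (a + c) S)"
    using c by (intro conv_mod.span_diff) (auto intro: conv_mod.span_base)
  ultimately show ?thesis
    by (intro conv_ideal_eqI) (auto intro: conv_mod.span_base)
qed

section \<open>Intersection numbers\<close>

lemma intersection_number_commute: "intersection_number a b = intersection_number b a"
  by (simp add: intersection_number_def insert_commute)

lemma intersection_number_unit_left:
  "is_unit u \<Longrightarrow> intersection_number (u * a) b = intersection_number a b"
  by (simp add: intersection_number_def conv_ideal_insert_unit)

lemma intersection_number_unit_right:
  "is_unit u \<Longrightarrow> intersection_number a (u * b) = intersection_number a b"
  by (metis intersection_number_commute intersection_number_unit_left)

lemma intersection_number_add_multiple:
  "intersection_number a (b + a * c) = intersection_number a b"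
proof -
  have "a * c \<in> conv_ideal {a}"
    using conv_mod.span_scale[OF conv_mod.span_base, of a "{a}" c] by (simp add: mult.commute)
  from conv_ideal_insert_add[OF this, of b] show ?thesis
    by (simp add: intersection_number_def insert_commute)
qed

lemma intersection_number_mult:
  assumes "regular_pair a b"
  shows "intersection_number a (b * c) = intersection_number a b + intersection_number a c"
  using quot_dim_regular_mult[OF assms, of "{c}"] by (simp add: intersection_number_def)

lemma intersection_number_unit: "is_unit u \<Longrightarrow> intersection_number a u = 0"
proof -
  assume u: "is_unit u"
  have "basis_mod UNIV {}" by (simp add: basis_mod_def conv_vs.independent_empty)
  then have "quot_dim UNIV = enat (card ({} :: conv_series set))"
    by (intro quot_dim_eqI) (auto simp: conv_vs.subspace_UNIV)
  moreover have "conv_ideal {a, u} = UNIV"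
  proof -
    obtain v where v: "u * v = 1" using u by (metis dvdE)
    have "(x * v) * u \<in> conv_ideal {a, u}" for x
      by (intro conv_mod.span_scale conv_mod.span_base) simp
    moreover have "(x * v) * u = x" for x by (metis mult.assoc mult.commute mult.right_neutral v)
    ultimately show ?thesis by auto
  qed
  ultimately show ?thesis by (simp add: intersection_number_def zero_enat_def)
qed

section \<open>Derivations and points of the projective line\<close>

lemma conv_const_hom:
  "conv_const (c + d) = conv_const c + conv_const d"
  "conv_const (c - d) = conv_const c - conv_const d"
  "conv_const (c * d) = conv_const c * conv_const d"
  "conv_const 0 = 0" "conv_const 1 = 1"
  by (transfer; simp)+

lemma conv_const_unit: "c \<noteq> 0 \<Longrightarrow> is_unit (conv_const c)"
  by (rule dvdI[of _ _ "conv_const (1 / c)"]) (simp flip: conv_const_hom)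

text \<open>Both partial derivatives are instances, so each identity below is proved once for the
  two coefficients of a 1-form.\<close>

definition derivation :: "(conv_series \<Rightarrow> conv_series) \<Rightarrow> bool" where
  "derivation D \<longleftrightarrow> (\<forall>a b. D (a + b) = D a + D b) \<and> (\<forall>a b. D (a * b) = D a * b + a * D b) \<and>
     (\<forall>c. D (conv_const c) = 0)"

lemma derivationD:
  assumes "derivation D"
  shows "D (a + b) = D a + D b" "D (a * b) = D a * b + a * D b" "D (conv_const c) = 0"
  using assms by (auto simp: derivation_def)

lemma derivation_dx: "derivation conv_dx"
  unfolding derivation_def
  by (intro conjI allI; transfer; simp add: mult.commute add.commute)

lemma derivation_dy: "derivation conv_dy"
  unfolding derivation_def
proof (intro conjI allI)
  show "conv_dy (a + b) = conv_dy a + conv_dy b" for a b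
    by transfer (simp add: fps_eq_iff algebra_simps)
  show "conv_dy (a * b) = conv_dy a * b + a * conv_dy b" for a b
    by transfer
      (rule fps_ext, simp add: fps_mult_nth[where 'a = "complex fps"] sum.distrib[symmetric] fps_deriv_sum add.commute)
  show "conv_dy (conv_const c) = 0" for c
    by transfer (rule fps_ext, simp)
qed

text \<open>For nonzero \<open>p\<close> and \<open>q\<close> this vanishes exactly when they
  represent the same point.\<close>

definition pencil_det :: "complex \<times> complex \<Rightarrow> complex \<times> complex \<Rightarrow> complex" where
  "pencil_det p q = fst p * snd q - snd p * fst q"

lemma same_point_if_pencil_det_eq_0:
  assumes "p \<noteq> 0" "q \<noteq> 0" "pencil_det p q = 0"
  shows "same_point p q"
proof -
  obtain a b c d where pq: "p = (a, b)" "q = (c, d)" by (cases p, cases q)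
  have eq: "a * d = b * c" using assms(3) by (simp add: pencil_det_def pq)
  show ?thesis
  proof (cases "a = 0")
    case True
    then have "b \<noteq> 0" "c = 0" using assms(1) eq by (auto simp: pq zero_prod_def)
    then show ?thesis
      unfolding same_point_def using assms(2) True
      by (intro exI[of _ "d / b"]) (auto simp: pq zero_prod_def)
  next
    case False
    then have "d = c / a * b" using eq by (simp add: field_simps)
    moreover from this have "c \<noteq> 0" using assms(2) by (auto simp: pq zero_prod_def)
    ultimately show ?thesis
      unfolding same_point_def using False by (intro exI[of _ "c / a"]) (auto simp: pq)
  qed
qed

text \<open>Only finitely many slopes are forbidden. This supplies the auxiliary member
  \<open>L\<close> that differs from all factors of a product.\<close>

lemma exists_pencil_det_nonzero:
  assumes "\<And>i. i < n \<Longrightarrow> P i \<noteq> 0"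
  obtains s where "\<And>i. i < (n::nat) \<Longrightarrow> pencil_det (P i) s \<noteq> 0"
proof -
  obtain t where t: "t \<notin> (\<lambda>i. snd (P i) / fst (P i)) ` {..<n}"
    using ex_new_if_finite[OF infinite_UNIV_char_0[where 'a = complex]] by (metis finite_imageI finite_lessThan)
  have "pencil_det (P i) (1, t) \<noteq> 0" if "i < n" for i
  proof (cases "fst (P i) = 0")
    case True
    then show ?thesis using assms[OF that] by (auto simp: pencil_det_def zero_prod_def prod_eq_iff)
  next
    case False
    have "t \<noteq> snd (P i) / fst (P i)" using t that by auto
    then show ?thesis using False by (auto simp: pencil_det_def field_simps)
  qed
  then show ?thesis using that by blast
qed

text \<open>The two members differ by a constant unit, which passes through derivatives. This
  separates bifurcation points from generic ones.\<close>

lemma milnor_number_same_point: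
  assumes "same_point p q"
  shows "milnor_number (member f g q) = milnor_number (member f g p)"
proof -
  obtain c where c: "c \<noteq> 0" "fst q = c * fst p" "snd q = c * snd p"
    using assms by (auto simp: same_point_def)
  have m: "member f g q = conv_const c * member f g p"
    by (simp add: member_def conv_scale_def c conv_const_hom algebra_simps)
  have "D (member f g q) = conv_const c * D (member f g p)" if "derivation D" for D
    by (simp add: m derivationD[OF that])
  note D = this[OF derivation_dx] this[OF derivation_dy]
  have "conv_ideal {conv_const c * a, conv_const c * b} = conv_ideal {a, b}" for a b
    by (metis conv_ideal_insert_unit[OF conv_const_unit[OF c(1)]] insert_commute)
  then have "conv_ideal {conv_dx (member f g q), conv_dy (member f g q)}
      = conv_ideal {conv_dx (member f g p), conv_dy (member f g p)}" unfolding D .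
  then show ?thesis by (simp add: milnor_number_def)
qed

text \<open>For \<open>H = l\<^sub>0 \<cdots> l\<^sub>n\<^sub>-\<^sub>1\<close> the cofactor of \<open>\<omega>\<close> in \<open>L dH\<close>, i.e.
  \<open>\<Sum>\<^sub>i det(P\<^sub>i, s) \<Prod>\<^sub>k\<^sub>\<noteq>\<^sub>i l\<^sub>k\<close>.\<close>

primrec pencil_cofactor :: "conv_series \<Rightarrow> conv_series \<Rightarrow> (nat \<Rightarrow> complex \<times> complex) \<Rightarrow>
    complex \<times> complex \<Rightarrow> nat \<Rightarrow> conv_series" where
  "pencil_cofactor f g P s 0 = 0"
| "pencil_cofactor f g P s (Suc n) = pencil_cofactor f g P s n * member f g (P n)
     + conv_const (pencil_det (P n) s) * (\<Prod>i<n. member f g (P i))"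

text \<open>The expression \<open>b * D a - a * D b\<close> is bilinear over the constants and
  alternating, so passing from \<open>f\<close> and \<open>g\<close> to two members multiplies it by
  the determinant.\<close>

lemma member_wronskian:
  assumes "derivation D"
  shows "member f g s * D (member f g p)
    = member f g p * D (member f g s) + conv_const (pencil_det p s) * (g * D f - f * D g)"
  by (simp add: member_def conv_scale_def pencil_det_def derivationD[OF assms] conv_const_hom algebra_simps)

text \<open>By the Leibniz rule each factor contributes one copy of \<open>H * D L\<close> and,
  through its Wronskian with \<open>L\<close>, one term of the cofactor.\<close>

lemma member_times_derivation_prod:
  assumes "derivation D"
  shows "member f g s * D (\<Prod>i<n. member f g (P i))
    = of_nat n * (\<Prod>i<n. member f g (P i)) * D (member f g s)
      + pencil_cofactor f g P s n * (g * D f - f * D g)"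
proof (induction n)
  case 0
  have "D 1 = 0" using derivationD(3)[OF assms, of 1] by (simp add: conv_const_hom)
  then show ?case by simp
next
  case (Suc n)
  define L where "L = member f g s"
  define H where "H = (\<Prod>i<n. member f g (P i))"
  define l where "l = member f g (P n)"
  define w where "w = g * D f - f * D g"
  have "L * D (H * l) = (L * D H) * l + H * (L * D l)"
    by (simp add: derivationD[OF assms] algebra_simps)
  also have "L * D l = l * D L + conv_const (pencil_det (P n) s) * w"
    unfolding L_def l_def w_def by (rule member_wronskian[OF assms])
  also have "L * D H = of_nat n * H * D L + pencil_cofactor f g P s n * w"
    unfolding L_def H_def w_def by (rule Suc.IH)
  finally show ?case
    by (simp add: algebra_simps flip: L_def H_def l_def w_def)
qed

section \<open>Members of the pencil and their intersections\<close>

lemma isolated_singularity_common_zero: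
  assumes "isolated_singularity f g"
  shows "isolated_common_zero (omega_x f g) (omega_y f g)"
  using assms by (simp add: isolated_singularity_def isolated_common_zero_def)

text \<open>Both coefficients of the 1-form are combinations of \<open>f\<close> and
  \<open>g\<close>.\<close>

lemma isolated_common_zero_pencil:
  assumes "isolated_singularity f g"
  shows "isolated_common_zero f g"
proof (rule isolated_common_zero_combination)
  have "omega_x f g = - conv_dx g * f + conv_dx f * g" "omega_y f g = - conv_dy g * f + conv_dy f * g"
    by (simp_all add: omega_x_def omega_y_def algebra_simps)
  then show "isolated_common_zero (- conv_dx g * f + conv_dx f * g) (- conv_dy g * f + conv_dy f * g)"
    using isolated_singularity_common_zero[OF assms] by simp
qed

text \<open>Cramer's rule.\<close>

lemma pencil_from_members:
  assumes "pencil_det p q \<noteq> 0"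
  shows "f = conv_const (snd q / pencil_det p q) * member f g p
      + conv_const (- snd p / pencil_det p q) * member f g q"
    and "g = conv_const (- fst q / pencil_det p q) * member f g p
      + conv_const (fst p / pencil_det p q) * member f g q"
proof -
  have comb: "conv_const a * member f g p + conv_const b * member f g q
      = conv_const (a * fst p + b * fst q) * f + conv_const (a * snd p + b * snd q) * g" for a b
    by (simp add: member_def conv_scale_def conv_const_hom algebra_simps)
  have 1: "snd q / pencil_det p q * fst p + - snd p / pencil_det p q * fst q = 1"
      "- fst q / pencil_det p q * snd p + fst p / pencil_det p q * snd q = 1"
    using assms by (simp_all add: pencil_det_def divide_simps)
  have 0: "snd q / pencil_det p q * snd p + - snd p / pencil_det p q * snd q = 0"
      "- fst q / pencil_det p q * fst p + fst p / pencil_det p q * fst q = 0"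
    by simp_all
  show "f = conv_const (snd q / pencil_det p q) * member f g p
      + conv_const (- snd p / pencil_det p q) * member f g q"
    unfolding comb 1 0 by (simp add: conv_const_hom)
  show "g = conv_const (- fst q / pencil_det p q) * member f g p
      + conv_const (fst p / pencil_det p q) * member f g q"
    unfolding comb 1 0 by (simp add: conv_const_hom)
qed

text \<open>A zero member has zero Wronskian with another one, which would make both coefficients of
  the 1-form vanish identically.\<close>

lemma member_nonzero:
  assumes iso: "isolated_singularity f g" and det: "pencil_det p s \<noteq> 0"
  shows "member f g p \<noteq> 0"
proof
  assume 0: "member f g p = 0"
  have "conv_const (pencil_det p s) * (g * D f - f * D g) = 0" if "derivation D" for D
    using member_wronskian[OF that, of f g s p] derivationD(3)[OF that, of 0]
    by (simp add: 0 conv_const_hom)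
  moreover have "conv_const (pencil_det p s) \<noteq> 0"
    using conv_const_unit[OF det] by (metis not_is_unit_0)
  ultimately have "omega_x f g = 0" "omega_y f g = 0"
    using derivation_dx derivation_dy by (auto simp: omega_x_def omega_y_def)
  then show False
    using isolated_singularity_common_zero[OF iso] isolated_common_zero_y_regular y_regular_nonzero
    by metis
qed

text \<open>Two distinct members generate the ideal \<open>(f, g)\<close>, since \<open>f\<close>
  and \<open>g\<close> are recovered from them by Cramer's rule.\<close>

lemma members_intersection:
  assumes iso: "isolated_singularity f g" and "pencil_det p q \<noteq> 0"
  shows "regular_pair (member f g p) (member f g q)"
    and "intersection_number (member f g p) (member f g q) = intersection_number f g"
proof -
  note fg = pencil_from_members[OF assms(2), where f = f and g = g]
  have "isolated_common_zero (conv_const (snd q / pencil_det p q) * member f g p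
        + conv_const (- snd p / pencil_det p q) * member f g q)
      (conv_const (- fst q / pencil_det p q) * member f g p
        + conv_const (fst p / pencil_det p q) * member f g q)"
    using isolated_common_zero_pencil[OF iso] by (simp only: fg[symmetric])
  then have "isolated_common_zero (member f g p) (member f g q)"
    by (rule isolated_common_zero_combination)
  then show "regular_pair (member f g p) (member f g q)" by (rule regular_pair_of_isolated)
  have "conv_ideal {member f g p, member f g q} = conv_ideal {f, g}"
  proof (rule conv_ideal_eqI)
    have "member f g s \<in> conv_ideal {f, g}" for s
      unfolding member_def conv_scale_def
      by (intro conv_mod.span_add conv_mod.span_scale conv_mod.span_base) auto
    then show "x \<in> conv_ideal {f, g}" if "x \<in> {member f g p, member f g q}" for x
      using that by blast
    have "conv_const a * member f g p + conv_const b * member f g q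
        \<in> conv_ideal {member f g p, member f g q}" for a b
      by (intro conv_mod.span_add conv_mod.span_scale conv_mod.span_base) auto
    then show "x \<in> conv_ideal {member f g p, member f g q}" if "x \<in> {f, g}" for x
      using that fg by (metis empty_iff insert_iff)
  qed
  then show "intersection_number (member f g p) (member f g q) = intersection_number f g"
    by (simp add: intersection_number_def)
qed

lemma pencil_det_commute: "pencil_det p q \<noteq> 0 \<longleftrightarrow> pencil_det q p \<noteq> 0"
  by (auto simp: pencil_det_def mult.commute)

lemma member_prod_intersection:
  assumes iso: "isolated_singularity f g" and N: "intersection_number f g = enat N"
    and "\<And>i. i < n \<Longrightarrow> pencil_det (P i) q \<noteq> 0"
  shows "regular_pair (member f g q) (\<Prod>i<n. member f g (P i)) \<and>
    regular_pair (\<Prod>i<n. member f g (P i)) (member f g q) \<and>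
    intersection_number (member f g q) (\<Prod>i<n. member f g (P i)) = enat (n * N)"
  using assms(3)
proof (induction n)
  case 0
  then show ?case
    by (simp add: regular_pair_unit_right regular_pair_unit_left intersection_number_unit zero_enat_def)
next
  case (Suc n)
  note IH = Suc.IH[OF Suc.prems[OF less_SucI]]
  have det: "pencil_det (P n) q \<noteq> 0" "pencil_det q (P n) \<noteq> 0"
    using Suc.prems[of n] pencil_det_commute by auto
  show ?case
    using IH members_intersection[OF iso det(1)] members_intersection[OF iso det(2)] N
    by (auto simp: intersection_number_mult intro: regular_pair_mult_left regular_pair_mult_right)
qed

lemma member_prods_intersection:
  assumes iso: "isolated_singularity f g" and N: "intersection_number f g = enat N"
    and "\<And>i j. i < n \<Longrightarrow> j < m \<Longrightarrow> pencil_det (P i) (Q j) \<noteq> 0"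
  shows "intersection_number (\<Prod>i<n. member f g (P i)) (\<Prod>j<m. member f g (Q j)) = enat (n * m * N)"
  using assms(3)
proof (induction m)
  case 0
  then show ?case by (simp add: intersection_number_unit zero_enat_def)
next
  case (Suc m)
  have "regular_pair (\<Prod>i<n. member f g (P i)) (member f g (Q m))"
      "intersection_number (\<Prod>i<n. member f g (P i)) (member f g (Q m)) = enat (n * N)"
    using member_prod_intersection[OF iso N, of n P "Q m"] Suc.prems intersection_number_commute by auto
  then show ?case
    using Suc by (simp add: mult.commute[of _ "member f g (Q m)"] intersection_number_mult algebra_simps)
qed

text \<open>Adding a factor \<open>l\<close> turns the cofactor \<open>E\<close> into
  \<open>E * l + d * H\<close> with a constant unit \<open>d\<close>. It reduces to
  \<open>E * l\<close> modulo \<open>H\<close> and to \<open>d * H\<close> modulo \<open>l\<close>,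
  so both intersection numbers are known.\<close>

lemma pencil_cofactor_intersection:
  assumes iso: "isolated_singularity f g" and N: "intersection_number f g = enat N"
    and "\<And>i. i < n \<Longrightarrow> pencil_det (P i) s \<noteq> 0"
    and "\<And>i j. i < n \<Longrightarrow> j < n \<Longrightarrow> i \<noteq> j \<Longrightarrow> pencil_det (P i) (P j) \<noteq> 0"
  shows "regular_pair (\<Prod>i<n. member f g (P i)) (pencil_cofactor f g P s n) \<and>
    intersection_number (\<Prod>i<n. member f g (P i)) (pencil_cofactor f g P s n) = enat (n * (n - 1) * N)"
  using assms(3,4)
proof (induction n)
  case 0
  then show ?case
    by (simp add: regular_pair_unit_left intersection_number_unit[of 1] zero_enat_def
        intersection_number_commute[of 1])
next
  case (Suc n)
  define H where "H = (\<Prod>i<n. member f g (P i))"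
  define l where "l = member f g (P n)"
  define E where "E = pencil_cofactor f g P s n"
  define d where "d = conv_const (pencil_det (P n) s)"
  have IH: "regular_pair H E" "intersection_number H E = enat (n * (n - 1) * N)"
    using Suc by (auto simp: H_def E_def)
  have d: "is_unit d" unfolding d_def using Suc.prems(1) by (intro conv_const_unit) simp
  have lH: "regular_pair l H" "regular_pair H l" "intersection_number l H = enat (n * N)"
    unfolding l_def H_def using member_prod_intersection[OF iso N, of n P "P n"] Suc.prems by auto
  have E': "pencil_cofactor f g P s (Suc n) = E * l + H * d" "pencil_cofactor f g P s (Suc n) = d * H + l * E"
    by (simp_all add: E_def l_def d_def H_def mult.commute add.commute)
  have 1: "regular_pair H (pencil_cofactor f g P s (Suc n))"
    unfolding E'(1) by (intro regular_pair_add_multiple regular_pair_mult_right IH lH)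
  have 2: "regular_pair l (pencil_cofactor f g P s (Suc n))"
    unfolding E'(2)
    by (intro regular_pair_add_multiple regular_pair_mult_right regular_pair_unit_right d lH)
  have I1: "intersection_number H (pencil_cofactor f g P s (Suc n)) = enat (n * (n - 1) * N) + enat (n * N)"
    unfolding E'(1) intersection_number_add_multiple
    by (simp add: intersection_number_mult IH lH intersection_number_commute[of H l])
  have I2: "intersection_number l (pencil_cofactor f g P s (Suc n)) = enat (n * N)"
    unfolding E'(2) intersection_number_add_multiple
    by (simp add: intersection_number_unit_right d lH)
  \<comment> \<open>Regularity is needed in the other order, to apply additivity to the product
    \<open>H * l\<close>.\<close>
  have "H \<noteq> 0" using member_nonzero[OF iso Suc.prems(1)] by (simp add: H_def)
  then have "regular_pair (pencil_cofactor f g P s (Suc n)) H" by (rule regular_pair_commute[OF 1])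
  then have "intersection_number (H * l) (pencil_cofactor f g P s (Suc n))
      = enat (n * (n - 1) * N) + enat (n * N) + enat (n * N)"
    using I1 I2 intersection_number_commute[of _ "pencil_cofactor f g P s (Suc n)"]
    by (simp add: intersection_number_mult del: pencil_cofactor.simps)
  moreover have "n * (n - 1) * N + n * N + n * N = Suc n * (Suc n - 1) * N"
    by (cases n) (simp_all add: algebra_simps)
  ultimately show ?case
    using 1 2 by (simp add: regular_pair_mult_left flip: H_def l_def del: pencil_cofactor.simps)
qed

section \<open>Tjurina numbers of curves and of the foliation\<close>

lemma tjurina_number_unit:
  assumes "is_unit u"
  shows "tjurina_number (u * H) = tjurina_number H"
proof -
  have D: "conv_ideal (insert (D (u * H)) (insert H S)) = conv_ideal (insert (D H) (insert H S))"
    if "derivation D" for D S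
  proof -
    \<comment> \<open>This is the extra summand of the Leibniz rule; modulo \<open>H\<close> only
      \<open>u * D H\<close> remains.\<close>
    have "D u * H \<in> conv_ideal (insert H S)"
      by (intro conv_mod.span_scale conv_mod.span_base) simp
    from conv_ideal_insert_add[OF this, of "u * D H"] show ?thesis
      using conv_ideal_insert_unit[OF assms] by (simp add: derivationD[OF that] add.commute)
  qed
  have "conv_ideal {u * H, conv_dx (u * H), conv_dy (u * H)} = conv_ideal {H, conv_dx (u * H), conv_dy (u * H)}"
    by (rule conv_ideal_insert_unit[OF assms])
  also have "\<dots> = conv_ideal {H, conv_dx H, conv_dy (u * H)}"
    using D[OF derivation_dx, of "{conv_dy (u * H)}"] by (simp add: insert_commute)
  also have "\<dots> = conv_ideal {H, conv_dx H, conv_dy H}"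
    using D[OF derivation_dy, of "{conv_dx H}"] by (simp add: insert_commute)
  finally show ?thesis by (simp add: tjurina_number_def)
qed

lemma tjurina_fol_unit: "is_unit u \<Longrightarrow> tjurina_fol f g (u * H) = tjurina_fol f g H"
  using conv_ideal_insert_unit[of u H "{omega_x f g, omega_y f g}"]
  by (simp add: tjurina_fol_def insert_commute)

lemma tjurina_fol_finite:
  assumes "isolated_singularity f g"
  shows "tjurina_fol f g H \<noteq> \<infinity>"
proof -
  have "finite_quot (conv_ideal {omega_x f g, omega_y f g})"
    by (rule finite_quot_isolated[OF isolated_singularity_common_zero[OF assms]])
  then have "finite_quot (conv_ideal {omega_x f g, omega_y f g, H})"
    by (rule finite_quot_mono) (auto intro!: conv_mod.span_mono)
  then show ?thesis unfolding tjurina_fol_def quot_dim_ideal_finite_iff .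
qed

text \<open>Both sides are the colength of \<open>(H, L H\<^sub>x, L H\<^sub>y) = (H, E \<omega>\<^sub>x, E \<omega>\<^sub>y)\<close> for a member \<open>L\<close> of the
  pencil that does not divide \<open>H\<close> and the cofactor \<open>E\<close>.\<close>

lemma tjurina_number_member_prod:
  assumes iso: "isolated_singularity f g" and N: "intersection_number f g = enat N"
    and P: "\<And>i. i < n \<Longrightarrow> P i \<noteq> 0"
      "\<And>i j. i < n \<Longrightarrow> j < n \<Longrightarrow> i \<noteq> j \<Longrightarrow> pencil_det (P i) (P j) \<noteq> 0"
  defines "H \<equiv> \<Prod>i<n. member f g (P i)"
  shows "enat (n * N) + tjurina_number H = enat (n * (n - 1) * N) + tjurina_fol f g H"
proof -
  obtain s where s: "\<And>i. i < n \<Longrightarrow> pencil_det (P i) s \<noteq> 0"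
    using exists_pencil_det_nonzero[of n P] P(1) by blast
  define L where "L = member f g s"
  define E where "E = pencil_cofactor f g P s n"
  have L: "regular_pair H L" "intersection_number H L = enat (n * N)"
    using member_prod_intersection[OF iso N s] by (auto simp: H_def L_def intersection_number_commute)
  have E: "regular_pair H E" "intersection_number H E = enat (n * (n - 1) * N)"
    using pencil_cofactor_intersection[OF iso N s P(2)] by (auto simp: H_def E_def)
  have LD: "L * D H = E * (g * D f - f * D g) + (of_nat n * D L) * H" if "derivation D" for D
    using member_times_derivation_prod[OF that, of f g s P n]
    by (simp add: L_def E_def H_def mult_ac add.commute)
  \<comment> \<open>The part of \<open>L * D H\<close> that involves \<open>D L\<close> is a
    multiple of \<open>H\<close> and disappears from the ideal.\<close>
  have drop: "conv_ideal (insert (L * D H) (insert H S)) = conv_ideal (insert (E * (g * D f - f * D g)) (insert H S))"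
    if "derivation D" for D S
    unfolding LD[OF that]
    by (rule conv_ideal_insert_add) (intro conv_mod.span_scale conv_mod.span_base, simp)
  have "conv_ideal {H, L * conv_dx H, L * conv_dy H} = conv_ideal {H, E * omega_x f g, L * conv_dy H}"
    using drop[OF derivation_dx, of "{L * conv_dy H}"] by (simp add: insert_commute omega_x_def)
  also have "\<dots> = conv_ideal {H, E * omega_x f g, E * omega_y f g}"
    using drop[OF derivation_dy, of "{E * omega_x f g}"] by (simp add: insert_commute omega_y_def)
  finally have "quot_dim (conv_ideal (insert H ((*) L ` {conv_dx H, conv_dy H})))
      = quot_dim (conv_ideal (insert H ((*) E ` {omega_x f g, omega_y f g})))" by simp
  then show ?thesis
    unfolding quot_dim_regular_mult[OF L(1)] quot_dim_regular_mult[OF E(1)]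
    using L(2) E(2)
    by (simp add: intersection_number_def tjurina_number_def tjurina_fol_def insert_commute)
qed

text \<open>The Tjurina number of the foliation is finite, so the colength identity forces that of
  the curve to be finite and can be solved over the integers.\<close>

lemma tjurina_number_unit_member_prod:
  assumes iso: "isolated_singularity f g" and N: "intersection_number f g = enat N"
    and P: "\<And>i. i < n \<Longrightarrow> P i \<noteq> 0"
      "\<And>i j. i < n \<Longrightarrow> j < n \<Longrightarrow> i \<noteq> j \<Longrightarrow> pencil_det (P i) (P j) \<noteq> 0"
    and B: "is_unit u" "B = u * (\<Prod>i<n. member f g (P i))"
  shows "tjurina_number B \<noteq> \<infinity>"
    and "int (the_enat (tjurina_fol f g B))
      = int (the_enat (tjurina_number B)) - int n * (int n - 2) * int N"
proof -
  have eq: "enat (n * N) + tjurina_number B = enat (n * (n - 1) * N) + tjurina_fol f g B"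
    using tjurina_number_member_prod[OF iso N P] by (simp add: B tjurina_number_unit tjurina_fol_unit)
  obtain F where F: "tjurina_fol f g B = enat F" using tjurina_fol_finite[OF iso] by blast
  then obtain T where T: "tjurina_number B = enat T"
    using eq by (cases "tjurina_number B") auto
  then show "tjurina_number B \<noteq> \<infinity>" by simp
  have "n * N + T = n * (n - 1) * N + F" using eq F T by simp
  then have "int n * int N + int T = int n * int (n - 1) * int N + int F"
    by (simp flip: of_nat_mult of_nat_add)
  \<comment> \<open>The truncated \<open>n - 1\<close> at \<open>n = 0\<close> is harmless because
    of the factor \<open>n\<close>.\<close>
  moreover have "int n * int (n - 1) = int n * (int n - 1)" by (cases n) auto
  ultimately have "int n * int N + int T = int n * (int n - 1) * int N + int F" by (simp only:)
  then show "int (the_enat (tjurina_fol f g B))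
      = int (the_enat (tjurina_number B)) - int n * (int n - 2) * int N"
    using F T by (simp add: algebra_simps)
qed

section \<open>The balanced divisor\<close>

lemma equation_of_prod:
  assumes "\<And>i. i < r \<Longrightarrow> equation_of f g (p i) (h i)"
  obtains u where "is_unit u" "(\<Prod>i<r. h i) = u * (\<Prod>i<r. member f g (p i))"
proof -
  obtain u where u: "\<And>i. i < r \<Longrightarrow> is_unit (u i) \<and> h i = u i * member f g (p i)"
    using assms unfolding equation_of_def by metis
  have "(\<Prod>i<r. h i) = (\<Prod>i<r. u i) * (\<Prod>i<r. member f g (p i))"
    unfolding prod.distrib[symmetric] using u by (intro prod.cong) auto
  moreover have "is_unit (\<Prod>i\<in>A. u i)" if "A \<subseteq> {..<r}" for A
    using that by (induction A rule: infinite_finite_induct) (auto simp: u)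
  ultimately show ?thesis using that by blast
qed

text \<open>The finiteness claims guarantee that each \<open>the_enat\<close> in the formula returns
  an actual dimension.\<close>

theorem theorem4p7:
  fixes f g :: conv_series and r :: nat and h \<phi> :: "nat \<Rightarrow> conv_series"
  assumes "coprime f g"
    and "conv_eval f 0 = 0" and "conv_eval g 0 = 0"
    and "isolated_singularity f g"
    and "primitive_balanced_divisor f g r h \<phi>"
    and "B0 = zero_part f g r h" and "Boo = pole_part r \<phi>"
  shows "tjurina_fol f g B0 \<noteq> \<infinity> \<and> tjurina_fol f g Boo \<noteq> \<infinity> \<and> intersection_number B0 Boo \<noteq> \<infinity> \<and>
    tjurina_number B0 \<noteq> \<infinity> \<and> tjurina_number Boo \<noteq> \<infinity> \<and> intersection_number f g \<noteq> \<infinity> \<and>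
    tjurina_pair f g r h \<phi> = tjurina_fol_div f g B0 Boo \<and>
    tjurina_fol_div f g B0 Boo =
      int (the_enat (tjurina_number B0)) - int (the_enat (tjurina_number Boo))
      + int r * (int r - 2) * int (the_enat (intersection_number f g))"
proof -
  note iso = \<open>isolated_singularity f g\<close>
  obtain N where N: "intersection_number f g = enat N"
    using finite_quot_isolated[OF isolated_common_zero_pencil[OF iso]]
    by (auto simp: intersection_number_def simp flip: quot_dim_ideal_finite_iff)
  obtain p q where
    p': "\<forall>i<r. bifurcation_point f g (p i) \<and> \<not> same_point (p i) (1, 0) \<and>
          \<not> same_point (p i) (0, 1) \<and> equation_of f g (p i) (h i)"
      "\<forall>i<r. \<forall>j<r. i \<noteq> j \<longrightarrow> \<not> same_point (p i) (p j)" and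
    q': "\<forall>i<r. generic_point f g (q i) \<and> \<not> same_point (q i) (1, 0) \<and>
          \<not> same_point (q i) (0, 1) \<and> equation_of f g (q i) (\<phi> i)"
      "\<forall>i<r. \<forall>j<r. i \<noteq> j \<longrightarrow> \<not> same_point (q i) (q j)"
    using assms(5) unfolding primitive_balanced_divisor_def by (elim exE conjE) (rule that)
  note p = p'[rule_format] and q = q'[rule_format]
  \<comment> \<open>The points of \<open>f\<close> and \<open>g\<close> are appended to the
    bifurcation points, so that \<open>B0\<close> is a unit times a product of \<open>r + 2\<close>
    members.\<close>
  define P where "P = (\<lambda>i. if i < r then p i else if i = r then (1, 0) else (0, 1))"
  have p0: "p i \<noteq> 0" and q0: "q i \<noteq> 0" if "i < r" for i
    using p(1)[OF that] q(1)[OF that] by (auto simp: bifurcation_point_def generic_point_def)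
  have e0: "(1, 0) \<noteq> (0 :: complex \<times> complex)" "(0, 1) \<noteq> (0 :: complex \<times> complex)"
    by (auto simp: zero_prod_def)
  have P0: "P i \<noteq> 0" for i using p0 e0 by (auto simp: P_def)
  have det: "pencil_det s t \<noteq> 0" if "s \<noteq> 0" "t \<noteq> 0" "\<not> same_point s t" for s t
    using that same_point_if_pencil_det_eq_0 by blast
  have PP: "pencil_det (P i) (P j) \<noteq> 0" if "i < Suc (Suc r)" "j < Suc (Suc r)" "i \<noteq> j" for i j
  proof -
    have "pencil_det (P i) (P j) \<noteq> 0" if "i < j" "j < Suc (Suc r)" for i j
    proof (cases "i < r")
      case True
      then have "\<not> same_point (P i) (P j)"
        using p(1)[OF True] p(2)[OF True, of j] that by (auto simp: P_def)
      then show ?thesis by (intro det P0)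
    next
      case False
      then have "i = r" "j = Suc r" using that by auto
      then show ?thesis by (simp add: P_def pencil_det_def)
    qed
    then show ?thesis using that pencil_det_commute[of "P i" "P j"] by (metis linorder_neqE_nat)
  qed
  have qq: "pencil_det (q i) (q j) \<noteq> 0" if "i < r" "j < r" "i \<noteq> j" for i j
    using that q(2) by (intro det q0)
  \<comment> \<open>Bifurcation points and generic points have different Milnor numbers; the points
    of \<open>f\<close> and \<open>g\<close> are excluded for the poles by the definition of the
    divisor.\<close>
  have Pq: "pencil_det (P i) (q j) \<noteq> 0" if "i < Suc (Suc r)" "j < r" for i j
  proof (cases "i < r")
    case True
    have "\<not> same_point (p i) (q j)"
    proof
      assume "same_point (p i) (q j)"
      then have "milnor_number (member f g (q j)) = milnor_number (member f g (p i))"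
        by (rule milnor_number_same_point)
      then show False
        using p(1)[OF True] q(1)[OF that(2)] by (simp add: bifurcation_point_def generic_point_def)
    qed
    then show ?thesis using True det[OF p0 q0] that by (simp add: P_def)
  next
    case False
    then have "\<not> same_point (q j) (P i)" using q(1)[OF that(2)] by (auto simp: P_def)
    then have "pencil_det (q j) (P i) \<noteq> 0" by (intro det q0 P0 that(2))
    then show ?thesis using pencil_det_commute by blast
  qed
  have members: "member f g (1, 0) = f" "member f g (0, 1) = g"
    by (simp_all add: member_def)
  obtain u where u: "is_unit u" "(\<Prod>i<r. h i) = u * (\<Prod>i<r. member f g (p i))"
    using equation_of_prod p(1) by metis
  have B0: "B0 = u * (\<Prod>i<Suc (Suc r). member f g (P i))"
  proof -
    have "(\<Prod>i<r. member f g (P i)) = (\<Prod>i<r. member f g (p i))"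
      by (rule prod.cong) (auto simp: P_def)
    then show ?thesis
      using assms(6) u(2) by (simp add: zero_part_def members P_def mult_ac)
  qed
  obtain v where v: "is_unit v" "(\<Prod>i<r. \<phi> i) = v * (\<Prod>i<r. member f g (q i))"
    using equation_of_prod q(1) by metis
  have Boo: "Boo = v * (\<Prod>i<r. member f g (q i))" using assms(7) v(2) by (simp add: pole_part_def)
  have t0: "tjurina_number B0 \<noteq> \<infinity>" "int (the_enat (tjurina_fol f g B0))
      = int (the_enat (tjurina_number B0)) - int (Suc (Suc r)) * (int (Suc (Suc r)) - 2) * int N"
    by (rule tjurina_number_unit_member_prod[OF iso N P0 PP u(1) B0]; assumption)+
  have too: "tjurina_number Boo \<noteq> \<infinity>" "int (the_enat (tjurina_fol f g Boo))
      = int (the_enat (tjurina_number Boo)) - int r * (int r - 2) * int N"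
    by (rule tjurina_number_unit_member_prod[OF iso N q0 qq v(1) Boo]; assumption)+
  have I: "intersection_number B0 Boo = enat (Suc (Suc r) * r * N)"
    unfolding B0 Boo intersection_number_unit_left[OF u(1)] intersection_number_unit_right[OF v(1)]
    by (rule member_prods_intersection[OF iso N Pq])
  have "tjurina_pair f g r h \<phi> = tjurina_fol_div f g B0 Boo"
    using assms(6,7) by (simp add: tjurina_pair_def)
  \<comment> \<open>The correction \<open>(r + 2) * r * N\<close> for \<open>B0\<close> cancels
    against the intersection number, and the one for \<open>Boo\<close> remains with a positive
    sign.\<close>
  moreover have "tjurina_fol_div f g B0 Boo =
      int (the_enat (tjurina_number B0)) - int (the_enat (tjurina_number Boo))
      + int r * (int r - 2) * int (the_enat (intersection_number f g))"
    unfolding tjurina_fol_div_def t0(2) too(2) I N by (simp add: algebra_simps)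
  ultimately show ?thesis
    using tjurina_fol_finite[OF iso] t0(1) too(1) I N by simp
qed

end
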